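(* Let $M$ be a complex manifold that is Kobayashi hyperbolic and taut, and let $f$ be a holomorphic vector field on $M$ generating a complete holomorphic flow $\phi_t:M\to M$, $t\ge 0$, of $\dot z=f(z)$. Suppose the system $\dot z=f(z)$ is intrinsically contracting with rate $\lambda>0$, i.e. for every $z\in M$ and $v\in T_zM$, writing $z(t)=\phi_t(z)$ and $\delta z(t)=D\phi_t(z)v$, $$D^+F_K\big(z(t),\delta z(t)\big)\le-\lambda\,F_K\big(z(t),\delta z(t)\big)\qquad\text{for all } t\ge 0 .$$ Then $$d_K\big(\phi_t(x),\phi_t(y)\big)\le e^{-\lambda t}\,d_K(x,y)\qquad\text{for all }x,y\in M,\ t\ge 0 .$$
   Context: Complex manifolds are connected, $TM$ is the holomorphic tangent bundle, $D=\{\zeta\in\mathbb{C}:|\zeta|<1\}$, and $\mathcal{O}(D,M)$ is the set of holomorphic maps $D\to M$. The Kobayashi infinitesimal pseudometric is $$F_K(z,v)=\inf\{\lambda>0:\exists\,h\in\mathcal{O}(D,M),\ h(0)=z,\ h'(0)=v/\lambda\},\quad z\in M,\ v\in T_zM,$$ and the Kobayashi pseudodistance is $d_K(x,y)=\inf_\gamma\int_0^1F_K(\gamma(s),\dot\gamma(s))\,ds$ over piecewise smooth curves $\gamma:[0,1]\to M$ joining $x$ to $y$. $M$ is Kobayashi hyperbolic if $d_K$ is a genuine distance; $M$ is taut if $\mathcal{O}(D,M)$ is a normal family (every sequence has a subsequence that either converges locally uniformly to an element of $\mathcal{O}(D,M)$ or is compactly divergent). On a taut Kobayashi hyperbolic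 manifold, $F_K$ is jointly continuous on $TM\setminus\{0\}$ and $F_K(z,v)>0$ for $v\neq0$. The upper Dini derivative of $\psi:\mathbb{R}_{\ge0}\to\mathbb{R}$ is $D^+\psi(t)=\limsup_{\epsilon\to0^+}(\psi(t+\epsilon)-\psi(t))/\epsilon$; $D^+F_K(z(t),\delta z(t))$ denotes the upper Dini derivative of $t\mapsto F_K(z(t),\delta z(t))$. *)

theory Defs
  imports "HOL-Analysis.Analysis"
begin

section \<open>Complex manifolds\<close>

text \<open>A chart is a domain together with a coordinate map; values of the map outside the domain
  are irrelevant. A complex manifold is given by a topology \<open>X\<close>, whose underlying set is
  \<open>topspace X\<close>, and a (not necessarily maximal) holomorphic atlas \<open>A\<close>.\<close>

type_synonym ('a, 'n) chart = "'a set \<times> ('a \<Rightarrow> complex ^ 'n)"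

definition chart_inv :: "('a, 'n::finite) chart \<Rightarrow> complex ^ 'n \<Rightarrow> 'a" where
  "chart_inv c = inv_into (fst c) (snd c)"

text \<open>Complex (Frechet) differentiability at every point; only used for open \<open>S\<close>.\<close>

definition holomorphic_vec_on ::
    "(complex ^ 'n \<Rightarrow> complex ^ 'm) \<Rightarrow> (complex ^ 'n::finite) set \<Rightarrow> bool" where
  "holomorphic_vec_on g S \<longleftrightarrow>
     (\<forall>p\<in>S. \<exists>L. (g has_derivative L) (at p) \<and> (\<forall>a v. L (a *s v) = a *s L v))"

definition is_chart :: "'a topology \<Rightarrow> ('a, 'n::finite) chart \<Rightarrow> bool" where
  "is_chart X c \<longleftrightarrow>
     openin X (fst c) \<and> open (snd c ` fst c) \<and>
     homeomorphic_map (subtopology X (fst c)) (top_of_set (snd c ` fst c)) (snd c)"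

definition complex_manifold :: "'a topology \<Rightarrow> ('a, 'n::finite) chart set \<Rightarrow> bool" where
  "complex_manifold X A \<longleftrightarrow>
     Hausdorff_space X \<and> second_countable X \<and> connected_space X \<and>
     (\<forall>c\<in>A. is_chart X c) \<and> topspace X = (\<Union>c\<in>A. fst c) \<and>
     (\<forall>c\<in>A. \<forall>d\<in>A. holomorphic_vec_on (snd d \<circ> chart_inv c) (snd c ` (fst c \<inter> fst d)))"


section \<open>Tangent vectors and holomorphic maps\<close>

text \<open>A holomorphic tangent vector at \<open>z\<close> is the family of its coordinate vectors in all charts
  of the atlas around \<open>z\<close>, subject to the transformation rule under change of charts. The value
  at charts not containing \<open>z\<close> is normalised to \<open>0\<close>, so that equality of functions is equality of
  tangent vectors, and the vector space operations are pointwise.\<close>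

type_synonym ('a, 'n) tangent = "('a, 'n) chart \<Rightarrow> complex ^ 'n"

definition tangent_space :: "('a, 'n::finite) chart set \<Rightarrow> 'a \<Rightarrow> ('a, 'n) tangent set" where
  "tangent_space A z =
     {v. (\<forall>c. \<not> (c \<in> A \<and> z \<in> fst c) \<longrightarrow> v c = 0) \<and>
         (\<forall>c\<in>A. \<forall>d\<in>A. z \<in> fst c \<inter> fst d \<longrightarrow>
            v d = frechet_derivative (snd d \<circ> chart_inv c) (at (snd c z)) (v c))}"

definition holomorphic_self_map ::
    "'a topology \<Rightarrow> ('a, 'n::finite) chart set \<Rightarrow> ('a \<Rightarrow> 'a) \<Rightarrow> bool" where
  "holomorphic_self_map X A g \<longleftrightarrow>
     continuous_map X X g \<and>
     (\<forall>c\<in>A. \<forall>d\<in>A. holomorphic_vec_on (snd d \<circ> g \<circ> chart_inv c)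
        (snd c ` {p \<in> fst c. g p \<in> fst d}))"

text \<open>The differential \<open>Dg(z)v\<close>, a tangent vector at \<open>g z\<close>. It does not depend on the chart chosen
  around \<open>z\<close> when \<open>g\<close> is holomorphic and \<open>v\<close> is a tangent vector at \<open>z\<close>.\<close>

definition differential ::
    "('a, 'n::finite) chart set \<Rightarrow> ('a \<Rightarrow> 'a) \<Rightarrow> 'a \<Rightarrow> ('a, 'n) tangent \<Rightarrow> ('a, 'n) tangent" where
  "differential A g z v =
     (let c = (SOME c. c \<in> A \<and> z \<in> fst c) in
      (\<lambda>d. if d \<in> A \<and> g z \<in> fst d
           then frechet_derivative (snd d \<circ> g \<circ> chart_inv c) (at (snd c z)) (v c) else 0))"

definition holomorphic_vector_field ::
    "'a topology \<Rightarrow> ('a, 'n::finite) chart set \<Rightarrow> ('a \<Rightarrow> ('a, 'n) tangent) \<Rightarrow> bool" where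
  "holomorphic_vector_field X A f \<longleftrightarrow>
     (\<forall>z\<in>topspace X. f z \<in> tangent_space A z) \<and>
     (\<forall>c\<in>A. holomorphic_vec_on (\<lambda>p. f (chart_inv c p) c) (snd c ` fst c))"

text \<open>\<open>\<phi>\<close> is the flow of \<open>z' = f z\<close>, defined on all of \<open>M\<close> for all times \<open>t \<ge> 0\<close>, each \<open>\<phi> t\<close> being a
  holomorphic self-map. Nothing is assumed about negative times; at \<open>t = 0\<close> the time derivative
  is one-sided.\<close>

definition holomorphic_flow ::
    "'a topology \<Rightarrow> ('a, 'n::finite) chart set \<Rightarrow> ('a \<Rightarrow> ('a, 'n) tangent) \<Rightarrow>
     (real \<Rightarrow> 'a \<Rightarrow> 'a) \<Rightarrow> bool" where
  "holomorphic_flow X A f \<phi> \<longleftrightarrow>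
     (\<forall>t\<ge>0. holomorphic_self_map X A (\<phi> t)) \<and>
     (\<forall>z\<in>topspace X. \<phi> 0 z = z) \<and>
     (\<forall>z\<in>topspace X. \<forall>s\<ge>0. \<forall>t\<ge>0. \<phi> (s + t) z = \<phi> s (\<phi> t z)) \<and>
     (\<forall>z\<in>topspace X.
        continuous_map (top_of_set {0..}) X (\<lambda>t. \<phi> t z) \<and>
        (\<forall>t\<ge>0. \<forall>c\<in>A. \<phi> t z \<in> fst c \<longrightarrow>
           ((\<lambda>s. snd c (\<phi> s z)) has_vector_derivative f (\<phi> t z) c) (at t within {0..})))"


section \<open>The Kobayashi pseudometric and pseudodistance\<close>

text \<open>\<open>disc_maps X A\<close> is \<open>O(D,M)\<close>; values outside the unit disc are irrelevant.\<close>

definition disc_maps :: "'a topology \<Rightarrow> ('a, 'n::finite) chart set \<Rightarrow> (complex \<Rightarrow> 'a) set" where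
  "disc_maps X A =
     {h. continuous_map (top_of_set (ball 0 1)) X h \<and>
         (\<forall>c\<in>A. \<forall>i. (\<lambda>w. snd c (h w) $ i) holomorphic_on {w \<in> ball 0 1. h w \<in> fst c})}"

definition disc_deriv ::
    "('a, 'n::finite) chart set \<Rightarrow> (complex \<Rightarrow> 'a) \<Rightarrow> complex \<Rightarrow> ('a, 'n) tangent" where
  "disc_deriv A h w =
     (\<lambda>c. if c \<in> A \<and> h w \<in> fst c then (\<chi> i. deriv (\<lambda>u. snd c (h u) $ i) w) else 0)"

definition kobayashi_metric ::
    "'a topology \<Rightarrow> ('a, 'n::finite) chart set \<Rightarrow> 'a \<Rightarrow> ('a, 'n) tangent \<Rightarrow> real" where
  "kobayashi_metric X A z v =
     Inf {l. l > 0 \<and> (\<exists>h\<in>disc_maps X A. h 0 = z \<and> disc_deriv A h 0 = (\<lambda>c. v c /\<^sub>R l))}"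

text \<open>\<open>k\<close> times continuously differentiable; derivatives are taken within \<open>S\<close>. Below \<open>S\<close> is
  relatively open in a nondegenerate compact interval, so they are unique and one-sided at the
  endpoints of the interval.\<close>

primrec Ck_on :: "nat \<Rightarrow> (real \<Rightarrow> 'b::real_normed_vector) \<Rightarrow> real set \<Rightarrow> bool" where
  "Ck_on 0 g S \<longleftrightarrow> continuous_on S g"
| "Ck_on (Suc k) g S \<longleftrightarrow>
     (\<exists>g'. (\<forall>s\<in>S. (g has_vector_derivative g' s) (at s within S)) \<and> Ck_on k g' S)"

text \<open>Piecewise smooth curves \<open>[0,1] \<rightarrow> M\<close>: \<open>T\<close> is the set of nodes of a partition of \<open>[0,1]\<close>, and
  the curve is smooth on each closed subinterval between consecutive nodes.\<close>

definition piecewise_smooth_curve ::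
    "'a topology \<Rightarrow> ('a, 'n::finite) chart set \<Rightarrow> (real \<Rightarrow> 'a) \<Rightarrow> bool" where
  "piecewise_smooth_curve X A \<gamma> \<longleftrightarrow>
     continuous_map (top_of_set {0..1}) X \<gamma> \<and>
     (\<exists>T. finite T \<and> {0, 1} \<subseteq> T \<and> T \<subseteq> {0..1} \<and>
        (\<forall>a\<in>T. \<forall>b\<in>T. a < b \<and> T \<inter> {a<..<b} = {} \<longrightarrow>
           (\<forall>c\<in>A. \<forall>k. Ck_on k (snd c \<circ> \<gamma>) {s \<in> {a..b}. \<gamma> s \<in> fst c})))"

text \<open>At the finitely many nodes where the derivative may fail to exist the value is arbitrary.\<close>

definition velocity ::
    "('a, 'n::finite) chart set \<Rightarrow> (real \<Rightarrow> 'a) \<Rightarrow> real \<Rightarrow> ('a, 'n) tangent" where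
  "velocity A \<gamma> s =
     (\<lambda>c. if c \<in> A \<and> \<gamma> s \<in> fst c
          then vector_derivative (snd c \<circ> \<gamma>) (at s within {0..1}) else 0)"

definition kobayashi_length ::
    "'a topology \<Rightarrow> ('a, 'n::finite) chart set \<Rightarrow> (real \<Rightarrow> 'a) \<Rightarrow> ennreal" where
  "kobayashi_length X A \<gamma> =
     (\<integral>\<^sup>+ s\<in>{0..1}. ennreal (kobayashi_metric X A (\<gamma> s) (velocity A \<gamma> s)) \<partial>lborel)"

definition kobayashi_dist ::
    "'a topology \<Rightarrow> ('a, 'n::finite) chart set \<Rightarrow> 'a \<Rightarrow> 'a \<Rightarrow> ennreal" where
  "kobayashi_dist X A x y =
     (INF \<gamma>\<in>{\<gamma>. piecewise_smooth_curve X A \<gamma> \<and> \<gamma> 0 = x \<and> \<gamma> 1 = y}. kobayashi_length X A \<gamma>)"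

text \<open>\<open>Metric_space\<close> demands nonnegativity and symmetry also outside of \<open>topspace X\<close>. There the
  infimum is over the empty set and the real-valued distance is \<open>0\<close>, so nothing is added.\<close>

definition kobayashi_hyperbolic :: "'a topology \<Rightarrow> ('a, 'n::finite) chart set \<Rightarrow> bool" where
  "kobayashi_hyperbolic X A \<longleftrightarrow>
     (\<forall>x\<in>topspace X. \<forall>y\<in>topspace X. kobayashi_dist X A x y < \<infinity>) \<and>
     Metric_space (topspace X) (\<lambda>x y. enn2real (kobayashi_dist X A x y))"


section \<open>Tautness\<close>

text \<open>Locally uniform convergence of maps into \<open>X\<close>, i.e. convergence in the compact-open topology
  (which for any metric inducing \<open>X\<close> is uniform convergence on compact subsets of the disc).\<close>

definition locally_uniform_limit ::
    "'a topology \<Rightarrow> (nat \<Rightarrow> complex \<Rightarrow> 'a) \<Rightarrow> (complex \<Rightarrow> 'a) \<Rightarrow> bool" where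
  "locally_uniform_limit X hs h \<longleftrightarrow>
     (\<forall>K V. compact K \<and> K \<subseteq> ball 0 1 \<and> openin X V \<and> h ` K \<subseteq> V \<longrightarrow>
        (\<forall>\<^sub>F n in sequentially. hs n ` K \<subseteq> V))"

definition compactly_divergent :: "'a topology \<Rightarrow> (nat \<Rightarrow> complex \<Rightarrow> 'a) \<Rightarrow> bool" where
  "compactly_divergent X hs \<longleftrightarrow>
     (\<forall>K L. compact K \<and> K \<subseteq> ball 0 1 \<and> compactin X L \<longrightarrow>
        (\<forall>\<^sub>F n in sequentially. hs n ` K \<inter> L = {}))"

definition taut :: "'a topology \<Rightarrow> ('a, 'n::finite) chart set \<Rightarrow> bool" where
  "taut X A \<longleftrightarrow>
     (\<forall>hs. range hs \<subseteq> disc_maps X A \<longrightarrow>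
        (\<exists>r::nat \<Rightarrow> nat. strict_mono r \<and>
           ((\<exists>h\<in>disc_maps X A. locally_uniform_limit X (hs \<circ> r) h) \<or>
            compactly_divergent X (hs \<circ> r))))"


section \<open>Intrinsic contraction\<close>

definition upper_Dini :: "(real \<Rightarrow> real) \<Rightarrow> real \<Rightarrow> ereal" where
  "upper_Dini \<psi> t = Limsup (at_right 0) (\<lambda>\<epsilon>. ereal ((\<psi> (t + \<epsilon>) - \<psi> t) / \<epsilon>))"

definition intrinsically_contracting ::
    "'a topology \<Rightarrow> ('a, 'n::finite) chart set \<Rightarrow> (real \<Rightarrow> 'a \<Rightarrow> 'a) \<Rightarrow> real \<Rightarrow> bool" where
  "intrinsically_contracting X A \<phi> l \<longleftrightarrow>
     (\<forall>z\<in>topspace X. \<forall>v\<in>tangent_space A z. \<forall>t\<ge>0.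
        upper_Dini (\<lambda>s. kobayashi_metric X A (\<phi> s z) (differential A (\<phi> s) z v)) t
          \<le> ereal (- l * kobayashi_metric X A (\<phi> t z) (differential A (\<phi> t) z v)))"

end

theory Submission
  imports Defs "HOL-Complex_Analysis.Cauchy_Integral_Formula"
begin

text \<open>
  Fix a tangent vector \<open>v\<close> at \<open>z\<close> and let \<open>\<psi>(t) = F\<^sub>K(\<phi>\<^sub>t z, D\<phi>\<^sub>t(z)v)\<close>. The hypothesis bounds the upper
  Dini derivative of \<open>\<psi>\<close> by \<open>-\<lambda>\<psi>\<close>, and the first point is to integrate this to
  \<open>\<psi>(t) \<le> e\<^sup>-\<^sup>\<lambda>\<^sup>t \<psi>(0)\<close>. A differential inequality for a right Dini derivative can be integrated only under
  some regularity from the left. Here this comes from the Schwarz lemma: holomorphic maps do not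
  increase \<open>F\<^sub>K\<close> (\<open>kobayashi_metric_decreasing\<close>), and \<open>\<phi>\<^sub>t = \<phi>\<^sub>t\<^sub>-\<^sub>s \<circ> \<phi>\<^sub>s\<close>, so \<open>\<psi>\<close> is nonincreasing, which is
  enough (\<open>Dini_Gronwall_antimono\<close>). Hence each \<open>\<phi>\<^sub>t\<close> contracts \<open>F\<^sub>K\<close> by the factor \<open>e\<^sup>-\<^sup>\<lambda>\<^sup>t\<close>
  (\<open>kobayashi_metric_flow_decay\<close>).

  The second point is to integrate this over curves. If \<open>\<gamma>\<close> joins \<open>x\<close> to \<open>y\<close>, then \<open>\<phi>\<^sub>t \<circ> \<gamma>\<close> joins \<open>\<phi>\<^sub>t x\<close>
  to \<open>\<phi>\<^sub>t y\<close>, and its velocity is the image of that of \<open>\<gamma>\<close> under the differential, except at the nodes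
  (\<open>velocity_push_forward\<close>). So its length is at most \<open>e\<^sup>-\<^sup>\<lambda>\<^sup>t\<close> times the length of \<open>\<gamma>\<close>, and taking the
  infimum over \<open>\<gamma>\<close> gives the theorem (\<open>kobayashi_dist_self_map_le\<close>).

  For \<open>\<phi>\<^sub>t \<circ> \<gamma>\<close> to compete in the definition of the distance it must be piecewise smooth. Since holomorphic
  maps are given as complex differentiable maps of several variables, this requires that such maps are
  infinitely differentiable. By Cauchy's formula on complex lines their directional derivatives are
  parameter integrals, which can be differentiated once more; so the directional derivatives are again
  holomorphic (\<open>holomorphic_vec_on_directional_derivative\<close>), and the chain rule gives smoothness of the
  composition by induction (\<open>Ck_on_compose_holomorphic_vec\<close>).
\<close>

section \<open>Dini derivatives and lower integrals\<close>

text \<open>Induction along the half-line: if \<open>P\<close> failed somewhere, it would hold before the infimum of the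
  failures, hence at the infimum by \<open>limit\<close>, and hence a little beyond it by \<open>step\<close>.\<close>
lemma nonneg_interval_induct [consumes 1, case_names limit step]:
  fixes t :: real
  assumes "0 \<le> t"
    and limit: "\<And>t. 0 \<le> t \<Longrightarrow> (\<And>s. 0 \<le> s \<Longrightarrow> s < t \<Longrightarrow> P s) \<Longrightarrow> P t"
    and step: "\<And>t. 0 \<le> t \<Longrightarrow> P t \<Longrightarrow> \<exists>\<eta>>0. \<forall>s\<in>{t<..<t + \<eta>}. P s"
  shows "P t"
proof (rule ccontr)
  assume "\<not> P t"
  define B where "B = {t. 0 \<le> t \<and> \<not> P t}"
  have B: "t \<in> B" "bdd_below B"
    using \<open>0 \<le> t\<close> \<open>\<not> P t\<close> by (auto simp: B_def intro!: bdd_belowI[of _ 0])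
  define m where "m = Inf B"
  have "0 \<le> m" unfolding m_def using B by (intro cInf_greatest) (auto simp: B_def)
  have below: "P s" if "0 \<le> s" "s < m" for s
    using that cInf_lower[of s B] B(2) unfolding m_def[symmetric] by (auto simp: B_def)
  then have "P m" using limit[of m] \<open>0 \<le> m\<close> by blast
  then obtain \<eta> where \<eta>: "\<eta> > 0" "\<forall>s\<in>{m<..<m + \<eta>}. P s" using step[of m] \<open>0 \<le> m\<close> by blast
  have "m + \<eta> \<le> Inf B"
  proof (rule cInf_greatest)
    fix b assume b: "b \<in> B"
    then have "\<not> b < m" "b \<noteq> m" using below \<open>P m\<close> by (auto simp: B_def)
    then show "m + \<eta> \<le> b" using b \<eta>(2) by (force simp: B_def)
  qed (use B in auto)
  then show False using \<eta>(1) by (simp add: m_def)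
qed

lemma upper_Dini_le_imp_eventually:
  assumes "upper_Dini \<psi> t \<le> ereal m" "m < m'"
  shows "\<exists>\<eta>>0. \<forall>e\<in>{0<..<\<eta>}. \<psi> (t + e) \<le> \<psi> t + m' * e"
proof -
  have "Limsup (at_right 0) (\<lambda>\<epsilon>. ereal ((\<psi> (t + \<epsilon>) - \<psi> t) / \<epsilon>)) < ereal m'"
    using assms unfolding upper_Dini_def by (meson ereal_less_le less_ereal.simps(1) le_less_trans)
  then have "\<forall>\<^sub>F \<epsilon> in at_right 0. ereal ((\<psi> (t + \<epsilon>) - \<psi> t) / \<epsilon>) < ereal m'"
    by (rule Limsup_lessD)
  then obtain \<eta> where "\<eta> > 0" "\<forall>e>0. e < \<eta> \<longrightarrow> (\<psi> (t + e) - \<psi> t) / e < m'"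
    unfolding eventually_at_right_field by auto
  then show ?thesis
    by (intro exI[of _ \<eta>]) (auto simp: field_simps intro: less_imp_le)
qed

text \<open>Gronwall's inequality for a Dini derivative. A bound on the right upper Dini derivative alone
  allows the function to jump upwards from its left limits, so some left regularity is required; monotonicity of \<open>\<psi>\<close>
  supplies exactly this, since it gives \<open>\<psi> t \<le> \<psi> s\<close> for \<open>s < t\<close>.\<close>
lemma Dini_Gronwall_antimono:
  fixes \<psi> :: "real \<Rightarrow> real"
  assumes anti: "\<And>s t. 0 \<le> s \<Longrightarrow> s \<le> t \<Longrightarrow> \<psi> t \<le> \<psi> s"
    and Dini: "\<And>t. 0 \<le> t \<Longrightarrow> upper_Dini \<psi> t \<le> ereal (- l * \<psi> t)"
    and "0 \<le> t"
  shows "\<psi> t \<le> exp (- l * t) * \<psi> 0"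
proof -
  define w where "w t = exp (l * t) * \<psi> t" for t
  \<comment> \<open>The weighted function \<open>w\<close> has nonpositive upper Dini derivative; the slack \<open>e * t\<close> turns this into a
    strict inequality that can be propagated to the right of every time.\<close>
  have bound: "w t \<le> \<psi> 0 + e * t" if "e > 0" "0 \<le> t" for e t
    using \<open>0 \<le> t\<close>
  proof (induction t rule: nonneg_interval_induct)
    case (limit t)
    show ?case
    proof (cases "t = 0")
      case True then show ?thesis by (simp add: w_def)
    next
      case False
      then have "0 < t" using limit by simp
      let ?u = "\<lambda>s. exp (l * (t - s)) * (\<psi> 0 + e * s)"
      have "(?u \<longlongrightarrow> ?u t) (at_left t)"
        by (intro tendsto_intros)
      moreover have "\<forall>\<^sub>F s in at_left t. w t \<le> ?u s"
        using eventually_at_left_real[OF \<open>0 < t\<close>]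
      proof eventually_elim
        case (elim s)
        have "w t \<le> exp (l * t) * \<psi> s"
          using anti[of s t] elim by (simp add: w_def)
        also have "\<dots> = exp (l * (t - s)) * w s"
          by (simp add: w_def algebra_simps flip: mult_exp_exp exp_add)
        also have "\<dots> \<le> ?u s" using limit elim by simp
        finally show ?case .
      qed
      ultimately have "w t \<le> ?u t" by (intro tendsto_lowerbound) auto
      then show ?thesis by simp
    qed
  next
    case (step t)
    \<comment> \<open>The tolerance in the Dini bound for \<open>\<psi>\<close> that costs \<open>w\<close> a slope of \<open>e / 2\<close> only.\<close>
    define d where "d = e * exp (- l * t) / 2"
    have "d > 0" using \<open>e > 0\<close> by (simp add: d_def)
    obtain \<eta>1 where \<eta>1: "\<eta>1 > 0" "\<forall>h\<in>{0<..<\<eta>1}. \<psi> (t + h) \<le> \<psi> t + (- l * \<psi> t + d) * h"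
      using upper_Dini_le_imp_eventually[OF Dini[of t], of "- l * \<psi> t + d"] \<open>d > 0\<close> step by auto
    let ?g = "\<lambda>h. w t + e * h - exp (l * h) * (w t + (- l * w t + e / 2) * h)"
    have "(?g has_real_derivative e / 2) (at 0)"
      by (auto intro!: derivative_eq_intros)
    then obtain \<eta>2 where \<eta>2: "\<eta>2 > 0" "\<forall>h>0. h < \<eta>2 \<longrightarrow> ?g 0 < ?g (0 + h)"
      using DERIV_pos_inc_right[of ?g "e / 2" 0] \<open>e > 0\<close> by auto
    show ?case
    proof (intro exI[of _ "min \<eta>1 \<eta>2"] conjI ballI)
      fix s assume s: "s \<in> {t<..<t + min \<eta>1 \<eta>2}"
      define h where "h = s - t"
      have h: "0 < h" "h < \<eta>1" "h < \<eta>2" and s_eq: "s = t + h" using s by (auto simp: h_def)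
      have "w s = exp (l * h) * (exp (l * t) * \<psi> (t + h))"
        by (simp add: w_def s_eq algebra_simps exp_add)
      also have "\<dots> \<le> exp (l * h) * (exp (l * t) * (\<psi> t + (- l * \<psi> t + d) * h))"
        using \<eta>1(2) h by simp
      also have "exp (l * t) * (\<psi> t + (- l * \<psi> t + d) * h) = w t + (- l * w t + e / 2) * h"
      proof -
        have "exp (l * t) * d = e / 2" by (simp add: d_def exp_minus)
        then show ?thesis by (simp add: w_def algebra_simps)
      qed
      also have "exp (l * h) * (w t + (- l * w t + e / 2) * h) \<le> w t + e * h"
        using \<eta>2(2) h by fastforce
      also have "\<dots> \<le> \<psi> 0 + e * s" using step by (simp add: s_eq algebra_simps)
      finally show "w s \<le> \<psi> 0 + e * s" .
    qed (use \<eta>1 \<eta>2 in auto)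
  qed
  have "w t \<le> \<psi> 0"
  proof (rule field_le_epsilon)
    fix e :: real assume "e > 0"
    have "w t \<le> \<psi> 0 + e / (t + 1) * t" using bound[of "e / (t + 1)" t] \<open>e > 0\<close> \<open>0 \<le> t\<close> by simp
    also have "e / (t + 1) * t \<le> e" using \<open>e > 0\<close> \<open>0 \<le> t\<close> by (simp add: field_simps)
    finally show "w t \<le> \<psi> 0 + e" by simp
  qed
  then show ?thesis
    by (simp add: w_def exp_minus field_simps)
qed

text \<open>The integral of an arbitrary nonnegative function is a supremum over the simple functions below
  it, and multiplication by \<open>1 / r\<close> maps simple functions below \<open>r * f\<close> to simple functions below \<open>f\<close>.
  In this form the bound applies to the length of a curve without a study of the measurability of
  the Kobayashi metric.\<close>

lemma nn_integral_cmult_le: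
  fixes r :: real
  assumes "r > 0"
  shows "(\<integral>\<^sup>+x. ennreal r * f x \<partial>M) \<le> ennreal r * (\<integral>\<^sup>+x. f x \<partial>M)"
  unfolding nn_integral_def[of M "\<lambda>x. ennreal r * f x"]
proof (rule SUP_least, clarify)
  fix g assume g: "simple_function M g" "g \<le> (\<lambda>x. ennreal r * f x)"
  let ?g = "\<lambda>x. ennreal (1 / r) * g x"
  have inv: "ennreal (1 / r) * ennreal r = 1"
    using assms by (simp flip: ennreal_mult)
  have [measurable]: "g \<in> borel_measurable M" by (rule borel_measurable_simple_function[OF g(1)])
  have "integral\<^sup>S M g = (\<integral>\<^sup>+x. g x \<partial>M)" by (simp add: nn_integral_eq_simple_integral g)
  also have "\<dots> = (\<integral>\<^sup>+x. ennreal r * ?g x \<partial>M)"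
    using inv by (simp add: mult.assoc[symmetric] mult.commute[of "ennreal r"])
  also have "\<dots> = ennreal r * (\<integral>\<^sup>+x. ?g x \<partial>M)" by (rule nn_integral_cmult) measurable
  also have "\<dots> \<le> ennreal r * (\<integral>\<^sup>+x. f x \<partial>M)"
  proof (intro mult_left_mono nn_integral_mono)
    fix x
    have "?g x \<le> ennreal (1 / r) * (ennreal r * f x)" using g(2) by (auto simp: le_fun_def intro: mult_left_mono)
    also have "\<dots> = f x" by (simp add: mult.assoc[symmetric] inv)
    finally show "?g x \<le> f x" .
  qed simp
  finally show "integral\<^sup>S M g \<le> ennreal r * (\<integral>\<^sup>+x. f x \<partial>M)" .
qed

section \<open>Holomorphic maps of several variables\<close>

lemma bounded_bilinear_vector_scalar_mult:
  "bounded_bilinear ((*s) :: complex \<Rightarrow> complex ^ 'n::finite \<Rightarrow> complex ^ 'n)"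
  unfolding bilinear_conv_bounded_bilinear[symmetric] bilinear_def
  by (auto intro!: linearI simp: vec_eq_iff algebra_simps)

lemmas continuous_on_vector_scalar_mult [continuous_intros] =
  bounded_bilinear.continuous_on[OF bounded_bilinear_vector_scalar_mult]

lemmas bounded_linear_vector_scalar_mult_left =
  bounded_bilinear.bounded_linear_left[OF bounded_bilinear_vector_scalar_mult]

lemma has_derivative_vec_componentwise:
  fixes f :: "'a::real_normed_vector \<Rightarrow> 'b::euclidean_space ^ 'n::finite"
  assumes "\<And>i. ((\<lambda>x. f x $ i) has_derivative (\<lambda>x. f' x $ i)) F"
  shows "(f has_derivative f') F"
proof -
  have bl: "bounded_linear (axis i :: 'b \<Rightarrow> 'b ^ 'n)" for i
    unfolding linear_conv_bounded_linear[symmetric] by (rule linearI) (auto simp: vec_eq_iff axis_def)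
  have exp: "x = (\<Sum>i\<in>UNIV. axis i (x $ i))" for x :: "'b ^ 'n"
    by (simp add: vec_eq_iff axis_def if_distrib cong: if_cong)
  have "((\<lambda>x. \<Sum>i\<in>UNIV. axis i (f x $ i)) has_derivative (\<lambda>x. \<Sum>i\<in>UNIV. axis i (f' x $ i))) F"
    by (intro has_derivative_sum bounded_linear.has_derivative[OF bl] assms)
  then show ?thesis by (simp flip: exp)
qed

lemma complex_line_derivative:
  fixes G :: "complex ^ 'n::finite \<Rightarrow> 'b::real_normed_vector"
  assumes "(G has_derivative L) (at (p + w *s e))"
  shows "((\<lambda>w. G (p + w *s e)) has_derivative (\<lambda>x. L (x *s e))) (at w)"
proof -
  have "((\<lambda>w. p + w *s e) has_derivative (\<lambda>x. x *s e)) (at w)"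
    using has_derivative_add[OF has_derivative_const
        bounded_linear_imp_has_derivative[OF bounded_linear_vector_scalar_mult_left]] by simp
  from has_derivative_compose[OF this assms] show ?thesis by simp
qed

text \<open>Cauchy's formula for the derivative at \<open>0\<close> of \<open>w \<mapsto> g (p + w *s e)\<close>, written as an integral over the
  parameter interval of the circle. The integrand involves values of \<open>g\<close> only, so regularity of \<open>g\<close>
  in \<open>p\<close> passes to its directional derivatives.\<close>
lemma directional_derivative_Cauchy:
  fixes g :: "complex ^ 'n::finite \<Rightarrow> complex"
  assumes "r > 0"
    and D: "\<And>w. w \<in> cball 0 r \<Longrightarrow> (g has_derivative D (p + w *s e)) (at (p + w *s e))"
    and hom: "\<And>w a v. w \<in> cball 0 r \<Longrightarrow> D (p + w *s e) (a *s v) = a * D (p + w *s e) v"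
  shows "((\<lambda>t. g (p + circlepath 0 r t *s e) / circlepath 0 r t) has_integral D p e) {0..1}"
proof -
  define f where "f w = g (p + w *s e)" for w
  have df: "(f has_field_derivative D (p + w *s e) e) (at w)" if "w \<in> cball 0 r" for w
  proof -
    have "(\<lambda>x. D (p + w *s e) (x *s e)) = (*) (D (p + w *s e) e)"
      by (simp add: fun_eq_iff hom[OF that])
    with complex_line_derivative[OF D[OF that]] show ?thesis
      by (simp add: f_def[abs_def] has_field_derivative_def)
  qed
  have cont: "continuous_on (cball 0 r) f"
    by (intro continuous_at_imp_continuous_on ballI DERIV_isCont[OF df])
  have hol: "f holomorphic_on ball 0 r"
    by (rule holomorphic_onI)
      (meson df ball_subset_cball subsetD field_differentiable_at_within field_differentiable_def)
  let ?I = "contour_integral (circlepath 0 r) (\<lambda>u. f u / (u - 0)\<^sup>2)"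
  have 0: "(0::complex) \<in> ball 0 r" using \<open>r > 0\<close> by simp
  note C = Cauchy_derivative_integral_circlepath[OF cont hol 0]
  have eq: "D p e = 1 / (2 * of_real pi * \<i>) * ?I"
    using DERIV_unique[OF df[of 0] C(2)] \<open>r > 0\<close> by simp
  have "((\<lambda>u. f u / (u - 0)\<^sup>2) has_contour_integral ?I) (circlepath 0 r)"
    using C(1) by (rule has_contour_integral_integral)
  then have "((\<lambda>t. f (circlepath 0 r t) / (circlepath 0 r t)\<^sup>2 *
      vector_derivative (circlepath 0 r) (at t within {0..1})) has_integral ?I) {0..1}"
    by (simp add: has_contour_integral_def)
  from has_integral_mult_right[OF this, of "1 / (2 * of_real pi * \<i>)"]
  have I: "((\<lambda>t. 1 / (2 * of_real pi * \<i>) * (f (circlepath 0 r t) / (circlepath 0 r t)\<^sup>2 *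
      vector_derivative (circlepath 0 r) (at t within {0..1}))) has_integral D p e) {0..1}"
    by (simp add: eq)
  show ?thesis
  proof (rule has_integral_eq[OF _ I])
    fix t :: real assume t: "t \<in> {0..1}"
    have "vector_derivative (circlepath 0 r) (at t within {0..1})
        = 2 * of_real pi * \<i> * circlepath 0 r t"
      using t by (subst vector_derivative_circlepath01) (simp_all add: circlepath)
    moreover have "circlepath 0 r t \<noteq> 0" using \<open>r > 0\<close> by (simp add: circlepath)
    ultimately show "1 / (2 * of_real pi * \<i>) * (f (circlepath 0 r t) / (circlepath 0 r t)\<^sup>2 *
      vector_derivative (circlepath 0 r) (at t within {0..1}))
      = g (p + circlepath 0 r t *s e) / circlepath 0 r t"
      by (simp add: f_def power2_eq_square field_simps)
  qed
qed

text \<open>The radius of the complex discs in direction \<open>e\<close> can be chosen uniformly near \<open>p\<close>, so that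
  Cauchy's formula is available with one circle for all centres near \<open>p\<close>.\<close>
lemma uniform_complex_line_in_open:
  fixes p e :: "complex ^ 'n::finite"
  assumes "open S" "p \<in> S"
  shows "\<exists>\<rho>>0. \<exists>r>0. \<forall>x\<in>ball p \<rho>. \<forall>w\<in>cball 0 r. x + w *s e \<in> S"
proof -
  let ?m = "\<lambda>y :: (complex ^ 'n) \<times> complex. fst y + snd y *s e"
  have "open (?m -` S)"
    by (intro open_vimage assms continuous_intros)
  moreover have "(p, 0) \<in> ?m -` S" using assms by simp
  ultimately obtain A B where "open A" "open B" "(p, 0) \<in> A \<times> B" "A \<times> B \<subseteq> ?m -` S"
    by (rule open_prod_elim)
  then have AB: "open A" "open B" "p \<in> A" "0 \<in> B" "A \<times> B \<subseteq> ?m -` S" by auto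
  obtain \<rho> where \<rho>: "\<rho> > 0" "ball p \<rho> \<subseteq> A" using AB openE by blast
  moreover obtain r where r: "r > 0" "cball 0 r \<subseteq> B" using AB open_contains_cball by blast
  moreover have "x + w *s e \<in> S" if "x \<in> ball p \<rho>" "w \<in> cball 0 r" for x w
  proof -
    have "(x, w) \<in> ?m -` S" using AB(5) that \<rho>(2) r(2) by blast
    then show ?thesis by simp
  qed
  ultimately show ?thesis by blast
qed

text \<open>Complex differentiability in the sense of Frechet presupposes no continuity of the derivative;
  Cauchy's formula expresses the derivative as a parameter integral of the continuous function \<open>g\<close>.\<close>
lemma continuous_on_directional_derivative:
  fixes g :: "complex ^ 'n::finite \<Rightarrow> complex"
  assumes "open S"
    and D: "\<And>q. q \<in> S \<Longrightarrow> (g has_derivative D q) (at q)"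
    and hom: "\<And>q a v. q \<in> S \<Longrightarrow> D q (a *s v) = a * D q v"
  shows "continuous_on S (\<lambda>q. D q e)"
proof (rule continuous_at_imp_continuous_on, rule ballI)
  fix p assume "p \<in> S"
  obtain \<rho> r where \<rho>r: "\<rho> > 0" "r > 0" "\<And>x w. x \<in> ball p \<rho> \<Longrightarrow> w \<in> cball 0 r \<Longrightarrow> x + w *s e \<in> S"
    using uniform_complex_line_in_open[OF \<open>open S\<close> \<open>p \<in> S\<close>, of e] by blast
  have circ: "circlepath 0 r t \<in> cball 0 r" "circlepath 0 r t \<noteq> 0" for t
    using \<open>r > 0\<close> by (auto simp: circlepath norm_mult)
  have contg: "continuous_on S g"
    by (intro continuous_at_imp_continuous_on ballI has_derivative_continuous[OF D])
  have "continuous_on (ball p \<rho> \<times> cbox 0 1)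
      (\<lambda>(x, t). g (x + circlepath 0 r t *s e) / circlepath 0 r t)"
    unfolding split_beta
    by (intro continuous_intros continuous_on_compose2[OF contg])
      (use circ \<rho>r(3) in \<open>auto simp: circlepath intro!: continuous_intros\<close>)
  then have "continuous_on (ball p \<rho>)
      (\<lambda>x. integral (cbox 0 1) (\<lambda>t. g (x + circlepath 0 r t *s e) / circlepath 0 r t))"
    by (rule integral_continuous_on_param)
  moreover have "integral (cbox 0 1) (\<lambda>t. g (x + circlepath 0 r t *s e) / circlepath 0 r t) = D x e"
    if "x \<in> ball p \<rho>" for x
    using directional_derivative_Cauchy[of r g D x e] \<rho>r that D hom by (simp add: integral_unique)
  ultimately have "continuous_on (ball p \<rho>) (\<lambda>x. D x e)"
    by (rule continuous_on_eq)
  then show "isCont (\<lambda>x. D x e) p"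
    using \<open>\<rho> > 0\<close> by (simp add: continuous_on_eq_continuous_at)
qed

text \<open>Differentiation of Cauchy's formula under the integral sign, which is legitimate because the first
  derivatives are continuous. The derivative of the integral is complex linear, being an integral of
  complex linear maps.\<close>
lemma directional_derivative_complex_differentiable:
  fixes g :: "complex ^ 'n::finite \<Rightarrow> complex"
  assumes "open S"
    and D: "\<And>q. q \<in> S \<Longrightarrow> (g has_derivative D q) (at q)"
    and hom: "\<And>q a v. q \<in> S \<Longrightarrow> D q (a *s v) = a * D q v"
    and "p \<in> S"
  shows "\<exists>L. ((\<lambda>q. D q e) has_derivative L) (at p) \<and> (\<forall>a v. L (a *s v) = a * L v)"
proof -
  obtain \<rho> r where \<rho>r: "\<rho> > 0" "r > 0" "\<And>x w. x \<in> ball p \<rho> \<Longrightarrow> w \<in> cball 0 r \<Longrightarrow> x + w *s e \<in> S"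
    using uniform_complex_line_in_open[OF \<open>open S\<close> \<open>p \<in> S\<close>, of e] by blast
  define c where "c = circlepath 0 r"
  have circ: "c t \<in> cball 0 r" "c t \<noteq> 0" for t
    using \<open>r > 0\<close> by (auto simp: c_def circlepath norm_mult)
  have contc: "continuous_on T c" for T
    by (auto simp: c_def circlepath[abs_def] intro!: continuous_intros)
  define K where "K x t = Blinfun (\<lambda>h. D (x + c t *s e) h / c t)" for x t
  have K: "blinfun_apply (K x t) = (\<lambda>h. D (x + c t *s e) h / c t)" if "x \<in> ball p \<rho>" for x t
  proof -
    have "bounded_linear (D (x + c t *s e))"
      using D[OF \<rho>r(3)[OF that circ(1)]] by (rule has_derivative_bounded_linear)
    then have "bounded_linear (\<lambda>h. D (x + c t *s e) h / c t)"
      by (rule bounded_linear_compose[OF bounded_linear_divide])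
    then show ?thesis by (simp add: K_def bounded_linear_Blinfun_apply)
  qed
  have contK: "continuous_on (ball p \<rho> \<times> cbox 0 1) (\<lambda>(x, t). K x t)"
  proof (rule continuous_on_blinfun_componentwise)
    fix i :: "complex ^ 'n"
    have "continuous_on (ball p \<rho> \<times> cbox 0 1) (\<lambda>y. D (fst y + c (snd y) *s e) i / c (snd y))"
      by (intro continuous_intros continuous_on_compose2[OF contc]
          continuous_on_compose2[OF continuous_on_directional_derivative[OF \<open>open S\<close> D hom]])
        (use circ \<rho>r(3) in auto)
    then show "continuous_on (ball p \<rho> \<times> cbox 0 1) (\<lambda>y. blinfun_apply (case y of (x, t) \<Rightarrow> K x t) i)"
      by (rule continuous_on_eq) (auto simp: K)
  qed
  have Cauchy: "((\<lambda>t. g (x + c t *s e) / c t) has_integral D x e) (cbox 0 1)" if "x \<in> ball p \<rho>" for x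
    using directional_derivative_Cauchy[of r g D x e] \<rho>r that D hom by (simp add: c_def)
  have "((\<lambda>x. integral (cbox 0 1) (\<lambda>t. g (x + c t *s e) / c t))
      has_derivative blinfun_apply (integral (cbox 0 1) (K p))) (at p within ball p \<rho>)"
  proof (rule leibniz_rule)
    fix x t assume x: "x \<in> ball p \<rho>"
    have "((\<lambda>x. x + c t *s e) has_derivative (\<lambda>h. h)) (at x)"
      using has_derivative_add[OF has_derivative_ident has_derivative_const] by simp
    from has_derivative_compose[OF this, of g "D (x + c t *s e)"] D[OF \<rho>r(3)[OF x circ(1)]]
    have "((\<lambda>x. g (x + c t *s e)) has_derivative D (x + c t *s e)) (at x)" by simp
    then have "((\<lambda>x. g (x + c t *s e) / c t) has_derivative (\<lambda>h. D (x + c t *s e) h / c t)) (at x)"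
      by (rule bounded_linear.has_derivative[OF bounded_linear_divide])
    then show "((\<lambda>x. g (x + c t *s e) / c t) has_derivative blinfun_apply (K x t)) (at x within ball p \<rho>)"
      by (simp add: K[OF x] has_derivative_at_withinI)
  qed (use Cauchy contK \<rho>r in auto)
  moreover have pb: "p \<in> ball p \<rho>" using \<open>\<rho> > 0\<close> by simp
  then have "at p within ball p \<rho> = at p" by (rule at_within_open) simp
  ultimately have "((\<lambda>x. integral (cbox 0 1) (\<lambda>t. g (x + c t *s e) / c t))
      has_derivative blinfun_apply (integral (cbox 0 1) (K p))) (at p)" by (simp only:)
  then have der: "((\<lambda>x. D x e) has_derivative blinfun_apply (integral (cbox 0 1) (K p))) (at p)"
    by (rule has_derivative_transform_within_open[OF _ open_ball pb]) (rule integral_unique[OF Cauchy])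
  have "continuous_on (cbox 0 1) (Pair p)" by (intro continuous_intros)
  moreover have "Pair p ` cbox 0 1 \<subseteq> ball p \<rho> \<times> cbox 0 1" using pb by auto
  ultimately have "continuous_on (cbox 0 1) (K p)"
    using continuous_on_compose2[OF contK] by force
  then have "K p integrable_on cbox 0 1" by (rule integrable_continuous)
  then have "blinfun_apply (integral (cbox 0 1) (K p)) (a *s v)
      = a * blinfun_apply (integral (cbox 0 1) (K p)) v" for a v
  proof -
    have "D (p + c t *s e) (a *s v) / c t = a * (D (p + c t *s e) v / c t)" for t
      using \<open>\<rho> > 0\<close> by (simp add: hom[OF \<rho>r(3)[OF _ circ(1)]])
    then show ?thesis
      using \<open>\<rho> > 0\<close> \<open>K p integrable_on cbox 0 1\<close>
      by (simp only: blinfun_apply_integral K centre_in_ball integral_mult_right)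
  qed
  with der show ?thesis by blast
qed

lemma frechet_derivative_holomorphic_vec:
  assumes "holomorphic_vec_on g S" "p \<in> S"
  shows "(g has_derivative frechet_derivative g (at p)) (at p)"
    and "frechet_derivative g (at p) (a *s v) = a *s frechet_derivative g (at p) v"
proof -
  obtain L where L: "(g has_derivative L) (at p)" "\<And>a v. L (a *s v) = a *s L v"
    using assms unfolding holomorphic_vec_on_def by blast
  show "(g has_derivative frechet_derivative g (at p)) (at p)"
    "frechet_derivative g (at p) (a *s v) = a *s frechet_derivative g (at p) v"
    using L by (simp_all flip: frechet_derivative_at)
qed

text \<open>The closure property that makes holomorphic maps infinitely differentiable by induction.\<close>
lemma holomorphic_vec_on_directional_derivative:
  fixes g :: "complex ^ 'n::finite \<Rightarrow> complex ^ 'm::finite"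
  assumes "open S" "holomorphic_vec_on g S"
  shows "holomorphic_vec_on (\<lambda>q. frechet_derivative g (at q) e) S"
  unfolding holomorphic_vec_on_def
proof
  fix p assume "p \<in> S"
  let ?D = "\<lambda>i q v. frechet_derivative g (at q) v $ i"
  note g = frechet_derivative_holomorphic_vec[OF assms(2)]
  have "\<exists>L. ((\<lambda>q. ?D i q e) has_derivative L) (at p) \<and> (\<forall>a v. L (a *s v) = a * L v)" for i
    by (rule directional_derivative_complex_differentiable[where g = "\<lambda>q. g q $ i" and S = S])
      (use assms(1) \<open>p \<in> S\<close> g in \<open>auto intro: bounded_linear.has_derivative[OF bounded_linear_vec_nth]\<close>)
  then obtain L where L: "\<And>i. ((\<lambda>q. ?D i q e) has_derivative L i) (at p)"
    "\<And>i a v. L i (a *s v) = a * L i v" by metis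
  show "\<exists>L. ((\<lambda>q. frechet_derivative g (at q) e) has_derivative L) (at p) \<and>
      (\<forall>a v. L (a *s v) = a *s L v)"
    by (rule exI[of _ "\<lambda>v. \<chi> i. L i v"])
      (auto simp: L vec_eq_iff intro!: has_derivative_vec_componentwise)
qed

section \<open>Calculus of \<open>k\<close> times differentiable curves\<close>

lemma Ck_on_SucE:
  assumes "Ck_on (Suc k) g S"
  obtains g' where "\<And>s. s \<in> S \<Longrightarrow> (g has_vector_derivative g' s) (at s within S)" "Ck_on k g' S"
  using assms by auto

lemma Ck_on_Suc_imp_Ck_on: "Ck_on (Suc k) g S \<Longrightarrow> Ck_on k g S"
proof (induction k arbitrary: g)
  case 0
  then show ?case by (auto intro: has_vector_derivative_continuous simp: continuous_on_eq_continuous_within)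
next
  case (Suc k)
  then show ?case by (metis Ck_on.simps(2))
qed

lemma Ck_on_subset: "Ck_on k g S \<Longrightarrow> T \<subseteq> S \<Longrightarrow> Ck_on k g T"
proof (induction k arbitrary: g)
  case (Suc k)
  then obtain g' where g': "\<And>s. s \<in> S \<Longrightarrow> (g has_vector_derivative g' s) (at s within S)" "Ck_on k g' S"
    by auto
  have "(g has_vector_derivative g' s) (at s within T)" if "s \<in> T" for s
    by (rule has_vector_derivative_within_subset[OF g'(1) Suc.prems(2)]) (use Suc.prems(2) that in blast)
  moreover have "Ck_on k g' T" by (rule Suc.IH[OF g'(2) Suc.prems(2)])
  ultimately show ?case unfolding Ck_on.simps by (intro exI[of _ g'] conjI ballI)
qed (simp add: continuous_on_subset)

lemma Ck_on_cong:
  assumes "Ck_on k f S" and eq: "\<And>s. s \<in> S \<Longrightarrow> g s = f s"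
  shows "Ck_on k g S"
proof (cases k)
  case 0
  then have "continuous_on S f" using assms(1) by simp
  then have "continuous_on S g" by (rule continuous_on_eq) (rule eq[symmetric])
  then show ?thesis by (simp add: 0)
next
  case (Suc k)
  then obtain f' where f': "\<forall>s\<in>S. (f has_vector_derivative f' s) (at s within S)" "Ck_on k f' S"
    using assms(1) by auto
  then have "(g has_vector_derivative f' s) (at s within S)" if "s \<in> S" for s
    using has_vector_derivative_transform[of s S g f, OF that eq] f'(1) that by blast
  with f'(2) show ?thesis unfolding Suc Ck_on.simps by (intro exI[of _ f'] conjI ballI)
qed

lemma Ck_on_zero: "Ck_on k (\<lambda>s. 0) S"
  by (induction k) (auto intro!: exI[of _ "\<lambda>s. 0"])

lemma Ck_on_add: "Ck_on k f S \<Longrightarrow> Ck_on k g S \<Longrightarrow> Ck_on k (\<lambda>s. f s + g s) S"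
proof (induction k arbitrary: f g)
  case (Suc k)
  obtain f' where "\<And>s. s \<in> S \<Longrightarrow> (f has_vector_derivative f' s) (at s within S)" "Ck_on k f' S"
    using Ck_on_SucE[OF Suc.prems(1)] by metis
  moreover obtain g' where "\<And>s. s \<in> S \<Longrightarrow> (g has_vector_derivative g' s) (at s within S)" "Ck_on k g' S"
    using Ck_on_SucE[OF Suc.prems(2)] by metis
  ultimately show ?case using Suc.IH
    by (auto intro!: exI[of _ "\<lambda>s. f' s + g' s"] has_vector_derivative_add)
qed (auto intro: continuous_on_add)

lemma Ck_on_sum:
  assumes "\<And>i. i \<in> I \<Longrightarrow> Ck_on k (f i) S"
  shows "Ck_on k (\<lambda>s. \<Sum>i\<in>I. f i s) S"
  using assms by (induction I rule: infinite_finite_induct) (auto simp: Ck_on_zero intro: Ck_on_add)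

lemma Ck_on_bounded_linear:
  assumes "bounded_linear L"
  shows "Ck_on k f S \<Longrightarrow> Ck_on k (\<lambda>s. L (f s)) S"
proof (induction k arbitrary: f)
  case 0
  then show ?case using bounded_linear.continuous_on[OF assms] by auto
next
  case (Suc k)
  then obtain f' where "\<And>s. s \<in> S \<Longrightarrow> (f has_vector_derivative f' s) (at s within S)" "Ck_on k f' S"
    by auto
  then show ?case using Suc.IH
    by (auto intro!: exI[of _ "\<lambda>s. L (f' s)"] bounded_linear.has_vector_derivative[OF assms])
qed

lemma Ck_on_bounded_bilinear:
  assumes "bounded_bilinear B"
  shows "Ck_on k f S \<Longrightarrow> Ck_on k g S \<Longrightarrow> Ck_on k (\<lambda>s. B (f s) (g s)) S"
proof (induction k arbitrary: f g)
  case 0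
  then show ?case using bounded_bilinear.continuous_on[OF assms] by auto
next
  case (Suc k)
  obtain f' where f': "\<And>s. s \<in> S \<Longrightarrow> (f has_vector_derivative f' s) (at s within S)" "Ck_on k f' S"
    using Ck_on_SucE[OF Suc.prems(1)] by metis
  obtain g' where g': "\<And>s. s \<in> S \<Longrightarrow> (g has_vector_derivative g' s) (at s within S)" "Ck_on k g' S"
    using Ck_on_SucE[OF Suc.prems(2)] by metis
  have "Ck_on k (\<lambda>s. B (f s) (g' s) + B (f' s) (g s)) S"
    using Suc.prems[THEN Ck_on_Suc_imp_Ck_on] f'(2) g'(2) by (intro Ck_on_add Suc.IH)
  moreover have "((\<lambda>s. B (f s) (g s)) has_vector_derivative B (f s) (g' s) + B (f' s) (g s)) (at s within S)"
    if "s \<in> S" for s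
    by (rule bounded_bilinear.has_vector_derivative[OF assms f'(1)[OF that] g'(1)[OF that]])
  ultimately show ?case by (auto intro!: exI[of _ "\<lambda>s. B (f s) (g' s) + B (f' s) (g s)"])
qed

text \<open>Being \<open>k\<close> times differentiable is a local property. A global derivative has to be assembled from
  local ones; these agree because in a relatively open subset of a nondegenerate interval every point
  is a limit point, so that derivatives within the set are unique.\<close>
lemma Ck_on_local:
  fixes a b :: real
  assumes "a < b" "open U\<^sub>0" and S: "S = {a..b} \<inter> U\<^sub>0"
    and "\<And>s. s \<in> S \<Longrightarrow> \<exists>U. open U \<and> s \<in> U \<and> Ck_on k g (S \<inter> U)"
  shows "Ck_on k g S"
  using assms(4)
proof (induction k arbitrary: g)
  case 0
  have "continuous (at s within S) g" if s: "s \<in> S" for s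
  proof -
    obtain U where U: "open U" "s \<in> U" "continuous_on (S \<inter> U) g" using 0[OF s] by auto
    then have "continuous (at s within S \<inter> U) g" using s by (simp add: continuous_on_eq_continuous_within)
    moreover have "at s within S \<inter> U = at s within S" by (rule at_within_nhd[OF U(2,1)]) auto
    ultimately show ?thesis by simp
  qed
  then show ?case by (simp add: continuous_on_eq_continuous_within)
next
  case (Suc k)
  define g' where "g' s = vector_derivative g (at s within S)" for s
  have loc: "\<exists>U. open U \<and> s \<in> U \<and> (\<forall>r\<in>S \<inter> U. (g has_vector_derivative g' r) (at r within S)) \<and> Ck_on k g' (S \<inter> U)"
    if s: "s \<in> S" for s
  proof -
    obtain U h where U: "open U" "s \<in> U" and
      h: "\<And>r. r \<in> S \<inter> U \<Longrightarrow> (g has_vector_derivative h r) (at r within S \<inter> U)" "Ck_on k h (S \<inter> U)"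
      using Suc.prems[OF s] by auto
    have der: "(g has_vector_derivative h r) (at r within S)" and eq: "g' r = h r" if r: "r \<in> S \<inter> U" for r
    proof -
      have "at r within S \<inter> U = at r within S" using r by (intro at_within_nhd[OF _ U(1)]) auto
      then show *: "(g has_vector_derivative h r) (at r within S)" using h(1)[OF r] by simp
      have "at r within S = at r within {a..b}"
        using r S \<open>open U\<^sub>0\<close> by (intro at_within_nhd[of _ U\<^sub>0]) auto
      then have "at r within S \<noteq> bot"
        using r S islimpt_Icc[OF \<open>a < b\<close>] by (simp add: trivial_limit_within)
      then show "g' r = h r" unfolding g'_def by (rule vector_derivative_within[OF _ *])
    qed
    have "Ck_on k g' (S \<inter> U)" by (rule Ck_on_cong[OF h(2) eq])
    then show ?thesis using U der eq by auto
  qed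
  have "(g has_vector_derivative g' s) (at s within S)" if "s \<in> S" for s using loc[OF that] that by blast
  moreover have "Ck_on k g' S" using loc by (intro Suc.IH) blast
  ultimately show ?case by auto
qed

text \<open>By the chain rule the derivative of \<open>G \<circ> u\<close> is the sum of the products of the components of \<open>u'\<close>
  with the partial derivatives of \<open>G\<close> along \<open>u\<close>. The partial derivatives are again holomorphic, so the
  induction on \<open>k\<close> is for all \<open>G\<close> simultaneously and \<open>u\<close> fixed.\<close>
lemma Ck_on_compose_holomorphic_vec:
  fixes G :: "complex ^ 'n::finite \<Rightarrow> complex ^ 'm::finite"
  assumes "open \<Omega>"
  shows "holomorphic_vec_on G \<Omega> \<Longrightarrow> Ck_on k u S \<Longrightarrow> u ` S \<subseteq> \<Omega> \<Longrightarrow> Ck_on k (\<lambda>s. G (u s)) S"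
proof (induction k arbitrary: G)
  case 0
  have "continuous_on \<Omega> G"
    by (intro continuous_at_imp_continuous_on ballI
        has_derivative_continuous[OF frechet_derivative_holomorphic_vec(1)[OF 0(1)]])
  then show ?case using 0 by (auto intro: continuous_on_compose2)
next
  case (Suc k)
  let ?D = "\<lambda>q. frechet_derivative G (at q)"
  note G = frechet_derivative_holomorphic_vec[OF Suc.prems(1)]
  obtain u' where u': "\<And>s. s \<in> S \<Longrightarrow> (u has_vector_derivative u' s) (at s within S)" "Ck_on k u' S"
    using Suc.prems(2) by auto
  let ?g' = "\<lambda>s. \<Sum>i\<in>UNIV. (u' s $ i) *s ?D (u s) (axis i 1)"
  have "Ck_on k ?g' S"
    using Suc.prems(1,3) Ck_on_Suc_imp_Ck_on[OF Suc.prems(2)] u'(2) \<open>open \<Omega>\<close>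
    by (intro Ck_on_sum Ck_on_bounded_bilinear[OF bounded_bilinear_vector_scalar_mult]
        Ck_on_bounded_linear[OF bounded_linear_vec_nth] Suc.IH holomorphic_vec_on_directional_derivative)
  moreover have "((\<lambda>s. G (u s)) has_vector_derivative ?g' s) (at s within S)" if s: "s \<in> S" for s
  proof -
    have us: "u s \<in> \<Omega>" using s Suc.prems(3) by auto
    have "?D (u s) (u' s) = ?D (u s) (\<Sum>i\<in>UNIV. (u' s $ i) *s axis i 1)" by (simp add: basis_expansion)
    also have "\<dots> = ?g' s"
      by (simp add: linear_sum[OF has_derivative_linear[OF G(1)[OF us]]] G(2)[OF us] del: vector_smult_component)
    finally show ?thesis
      using vector_derivative_diff_chain_within[OF u'(1)[OF s] has_derivative_at_withinI[OF G(1)[OF us]]]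
      by (simp add: o_def)
  qed
  ultimately show ?case unfolding Ck_on.simps by (intro exI[of _ ?g'] conjI ballI)
qed

section \<open>Charts and differentials\<close>

lemma of_real_vector_scalar_mult: "complex_of_real r *s v = r *\<^sub>R v"
  unfolding vec_eq_iff vector_smult_component vector_scaleR_component by (simp add: scaleR_conv_of_real)

lemma topspace_subtopology_chart: "is_chart X c \<Longrightarrow> topspace (subtopology X (fst c)) = fst c"
  unfolding is_chart_def by (auto dest: openin_subset)

lemma chart_inv_chart:
  assumes "is_chart X c" "p \<in> fst c"
  shows "chart_inv c (snd c p) = p"
proof -
  have "inj_on (snd c) (fst c)"
    using assms(1) topspace_subtopology_chart[OF assms(1)]
    by (metis homeomorphic_imp_injective_map is_chart_def)
  then show ?thesis unfolding chart_inv_def by (rule inv_into_f_f) (rule assms(2))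
qed

lemma open_chart_image:
  assumes c: "is_chart X c" and U: "openin X U" "U \<subseteq> fst c"
  shows "open (snd c ` U)"
proof -
  have "open_map (subtopology X (fst c)) (top_of_set (snd c ` fst c)) (snd c)"
    using c by (auto simp: is_chart_def intro: homeomorphic_imp_open_map)
  moreover have "openin (subtopology X (fst c)) U"
    using U by (auto simp: openin_subtopology intro!: exI[of _ U])
  ultimately have "openin (top_of_set (snd c ` fst c)) (snd c ` U)" by (simp add: open_map_def)
  then show ?thesis using c by (auto simp: is_chart_def intro: openin_open_trans)
qed

lemma continuous_map_chart_inv:
  assumes c: "is_chart X c"
  shows "continuous_map (top_of_set (snd c ` fst c)) X (chart_inv c)"
  unfolding continuous_map
proof (intro conjI allI impI)
  show "chart_inv c ` topspace (top_of_set (snd c ` fst c)) \<subseteq> topspace X"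
    using c openin_subset[of X "fst c"] by (auto simp: is_chart_def chart_inv_chart[OF c])
  fix V assume V: "openin X V"
  have "{x \<in> topspace (top_of_set (snd c ` fst c)). chart_inv c x \<in> V} = snd c ` (V \<inter> fst c)"
    by (auto simp: chart_inv_chart[OF c])
  moreover have "open (snd c ` (V \<inter> fst c))"
    using c V by (intro open_chart_image) (auto simp: is_chart_def)
  ultimately show "openin (top_of_set (snd c ` fst c)) {x \<in> topspace (top_of_set (snd c ` fst c)). chart_inv c x \<in> V}"
    using open_openin_trans[of "snd c ` fst c" "snd c ` (V \<inter> fst c)"] c by (auto simp: is_chart_def)
qed

text \<open>The differential of \<open>g\<close> at \<open>z\<close> in the chart \<open>c\<close> around \<open>z\<close> and the chart \<open>d\<close> around \<open>g z\<close>. For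
  \<open>g = id\<close> it is the transformation rule of tangent vectors.\<close>
definition coord_derivative ::
    "('a, 'n::finite) chart \<Rightarrow> ('a \<Rightarrow> 'a) \<Rightarrow> ('a, 'n) chart \<Rightarrow> 'a \<Rightarrow> complex ^ 'n \<Rightarrow> complex ^ 'n" where
  "coord_derivative c g d z = frechet_derivative (snd d \<circ> g \<circ> chart_inv c) (at (snd c z))"

locale complex_mfd =
  fixes X :: "'a topology" and A :: "('a, 'n::finite) chart set"
  assumes manifold: "complex_manifold X A"
begin

lemma chart: "c \<in> A \<Longrightarrow> is_chart X c"
  using manifold by (simp add: complex_manifold_def)

lemma chart_inv_eq [simp]: "c \<in> A \<Longrightarrow> p \<in> fst c \<Longrightarrow> chart_inv c (snd c p) = p"
  by (rule chart_inv_chart[OF chart])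

lemma openin_chart: "c \<in> A \<Longrightarrow> openin X (fst c)"
  using chart by (simp add: is_chart_def)

lemma chart_subset: "c \<in> A \<Longrightarrow> z \<in> fst c \<Longrightarrow> z \<in> topspace X"
  using openin_chart openin_subset by blast

definition chart_at :: "'a \<Rightarrow> ('a, 'n) chart" where
  "chart_at z = (SOME c. c \<in> A \<and> z \<in> fst c)"

lemma chart_at: "z \<in> topspace X \<Longrightarrow> chart_at z \<in> A \<and> z \<in> fst (chart_at z)"
proof -
  assume "z \<in> topspace X"
  then have "\<exists>c. c \<in> A \<and> z \<in> fst c" using manifold unfolding complex_manifold_def by blast
  then show ?thesis unfolding chart_at_def by (rule someI_ex)
qed

lemma differential_apply:
  "differential A g z v d = (if d \<in> A \<and> g z \<in> fst d
     then coord_derivative (chart_at z) g d z (v (chart_at z)) else 0)"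
  by (simp add: differential_def chart_at_def coord_derivative_def Let_def)

lemma holomorphic_self_map_id: "holomorphic_self_map X A id"
proof -
  have "{p \<in> fst c. id p \<in> fst d} = fst c \<inter> fst d" for c d :: "('a, 'n) chart" by auto
  then show ?thesis using manifold by (simp add: holomorphic_self_map_def complex_manifold_def)
qed

lemma self_map_continuous: "holomorphic_self_map X A g \<Longrightarrow> continuous_map X X g"
  unfolding holomorphic_self_map_def by (rule conjunct1)

lemma disc_maps_continuous: "h \<in> disc_maps X A \<Longrightarrow> continuous_map (top_of_set (ball 0 1)) X h"
  unfolding disc_maps_def by blast

lemma self_map_topspace: "holomorphic_self_map X A g \<Longrightarrow> z \<in> topspace X \<Longrightarrow> g z \<in> topspace X"
  by (auto simp: holomorphic_self_map_def continuous_map_def)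

lemma open_coord_domain:
  assumes "holomorphic_self_map X A g" "c \<in> A" "d \<in> A"
  shows "open (snd c ` {p \<in> fst c. g p \<in> fst d})"
proof (rule open_chart_image[OF chart[OF \<open>c \<in> A\<close>]])
  have "openin X (fst c \<inter> {p \<in> topspace X. g p \<in> fst d})"
    by (intro openin_Int openin_continuous_map_preimage[OF self_map_continuous] openin_chart assms)
  also have "fst c \<inter> {p \<in> topspace X. g p \<in> fst d} = {p \<in> fst c. g p \<in> fst d}"
    using chart_subset[OF \<open>c \<in> A\<close>] by auto
  finally show "openin X {p \<in> fst c. g p \<in> fst d}" .
qed auto

lemma coord_derivative:
  assumes "holomorphic_self_map X A g" "c \<in> A" "d \<in> A" "z \<in> fst c" "g z \<in> fst d"
  shows "((snd d \<circ> g \<circ> chart_inv c) has_derivative coord_derivative c g d z) (at (snd c z))"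
    and "coord_derivative c g d z (a *s v) = a *s coord_derivative c g d z v"
proof -
  have "holomorphic_vec_on (snd d \<circ> g \<circ> chart_inv c) (snd c ` {p \<in> fst c. g p \<in> fst d})"
    using assms by (simp add: holomorphic_self_map_def)
  moreover have "snd c z \<in> snd c ` {p \<in> fst c. g p \<in> fst d}" using assms by auto
  ultimately show "((snd d \<circ> g \<circ> chart_inv c) has_derivative coord_derivative c g d z) (at (snd c z))"
    "coord_derivative c g d z (a *s v) = a *s coord_derivative c g d z v"
    unfolding coord_derivative_def by (fact frechet_derivative_holomorphic_vec)+
qed

text \<open>The chain rule through an intermediate chart. The composite may be any map \<open>k\<close> that agrees with
  \<open>g' \<circ> g\<close> on the manifold, because a flow satisfies its semigroup law only there.\<close>
lemma coord_derivative_chain: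
  assumes g: "holomorphic_self_map X A g" "holomorphic_self_map X A g'"
    and comp: "\<And>p. p \<in> topspace X \<Longrightarrow> k p = g' (g p)"
    and "c \<in> A" "d \<in> A" "e \<in> A" "z \<in> fst c" "g z \<in> fst d" "g' (g z) \<in> fst e"
  shows "coord_derivative c k e z v = coord_derivative d g' e (g z) (coord_derivative c g d z v)"
proof -
  let ?G = "snd d \<circ> g \<circ> chart_inv c" and ?G' = "snd e \<circ> g' \<circ> chart_inv d"
  have "?G (snd c z) = snd d (g z)" using assms by simp
  then have "(?G' \<circ> ?G has_derivative coord_derivative d g' e (g z) \<circ> coord_derivative c g d z) (at (snd c z))"
    using assms by (intro diff_chain_at coord_derivative(1)) (auto intro: coord_derivative(1))
  then have "(snd e \<circ> k \<circ> chart_inv c has_derivative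
      coord_derivative d g' e (g z) \<circ> coord_derivative c g d z) (at (snd c z))"
    by (rule has_derivative_transform_within_open[OF _ open_coord_domain[OF g(1) \<open>c \<in> A\<close> \<open>d \<in> A\<close>]])
      (use assms chart_subset[OF \<open>c \<in> A\<close>] in auto)
  from frechet_derivative_at[OF this] show ?thesis by (simp add: coord_derivative_def fun_eq_iff)
qed

lemma tangent_space_alt:
  "v \<in> tangent_space A z \<longleftrightarrow>
     (\<forall>c. \<not> (c \<in> A \<and> z \<in> fst c) \<longrightarrow> v c = 0) \<and>
     (\<forall>c\<in>A. \<forall>d\<in>A. z \<in> fst c \<longrightarrow> z \<in> fst d \<longrightarrow> v d = coord_derivative c id d z (v c))"
  by (auto simp: tangent_space_def coord_derivative_def)

lemma tangent_space_transform:
  assumes "v \<in> tangent_space A z" "c \<in> A" "d \<in> A" "z \<in> fst c" "z \<in> fst d"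
  shows "v d = coord_derivative c id d z (v c)"
  by (rule assms(1)[unfolded tangent_space_alt, THEN conjunct2, rule_format]) (use assms in auto)

lemma tangent_space_zero:
  assumes "v \<in> tangent_space A z" "\<not> (c \<in> A \<and> z \<in> fst c)"
  shows "v c = 0"
  using assms(1)[unfolded tangent_space_alt, THEN conjunct1, rule_format, of c] assms(2) by simp

lemma differential_in_tangent_space:
  assumes "holomorphic_self_map X A g" "z \<in> topspace X"
  shows "differential A g z v \<in> tangent_space A (g z)"
proof -
  have "differential A g z v d = coord_derivative c id d (g z) (differential A g z v c)"
    if "c \<in> A" "d \<in> A" "g z \<in> fst c" "g z \<in> fst d" for c d
  proof -
    have "coord_derivative (chart_at z) g d z (v (chart_at z)) =
        coord_derivative c id d (g z) (coord_derivative (chart_at z) g c z (v (chart_at z)))"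
      using that chart_at[OF assms(2)]
      by (intro coord_derivative_chain[OF assms(1) holomorphic_self_map_id]) auto
    then show ?thesis using that by (simp add: differential_apply)
  qed
  moreover have "differential A g z v c = 0" if "\<not> (c \<in> A \<and> g z \<in> fst c)" for c
    using that by (simp add: differential_apply del: de_Morgan_conj)
  ultimately show ?thesis unfolding tangent_space_alt by blast
qed

lemma differential_compose:
  assumes g: "holomorphic_self_map X A g" "holomorphic_self_map X A g'"
    and comp: "\<And>p. p \<in> topspace X \<Longrightarrow> k p = g' (g p)" and z: "z \<in> topspace X"
  shows "differential A k z v = differential A g' (g z) (differential A g z v)"
proof
  fix d
  let ?c = "chart_at z" and ?c' = "chart_at (g z)"
  have c: "?c \<in> A" "z \<in> fst ?c" "?c' \<in> A" "g z \<in> fst ?c'"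
    using chart_at[OF z] chart_at[OF self_map_topspace[OF g(1) z]] by auto
  have "coord_derivative ?c k d z (v ?c) =
      coord_derivative ?c' g' d (g z) (coord_derivative ?c g ?c' z (v ?c))" if "d \<in> A" "g' (g z) \<in> fst d"
    by (rule coord_derivative_chain[OF g comp]) (use c that in auto)
  then show "differential A k z v d = differential A g' (g z) (differential A g z v) d"
    using c by (simp add: differential_apply comp[OF z])
qed

lemma differential_scaleR:
  assumes "holomorphic_self_map X A g" "z \<in> topspace X"
  shows "differential A g z (\<lambda>c. r *\<^sub>R v c) = (\<lambda>c. r *\<^sub>R differential A g z v c)"
  using linear_scale[OF has_derivative_linear[OF coord_derivative(1)[OF assms(1)]]] chart_at[OF assms(2)]
  by (auto simp: differential_apply fun_eq_iff)

section \<open>Holomorphic discs and the Schwarz lemma\<close>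

lemma disc_maps_has_derivative:
  assumes "h \<in> disc_maps X A" "w \<in> ball 0 1" "c \<in> A" "h w \<in> fst c"
  shows "((\<lambda>u. snd c (h u)) has_derivative (\<lambda>x. x *s disc_deriv A h w c)) (at w)"
    and "open {w \<in> ball 0 1. h w \<in> fst c}"
proof -
  let ?W = "{w \<in> ball 0 1. h w \<in> fst c}"
  have "openin (top_of_set (ball 0 1)) {w \<in> topspace (top_of_set (ball 0 1)). h w \<in> fst c}"
    by (intro openin_continuous_map_preimage[OF disc_maps_continuous] openin_chart assms)
  then show W: "open ?W"
    using openin_open_trans[of "ball (0::complex) 1" ?W] by simp
  have "((\<lambda>u. snd c (h u) $ i) has_derivative (\<lambda>x. x * disc_deriv A h w c $ i)) (at w)" for i
  proof -
    have "(\<lambda>u. snd c (h u) $ i) holomorphic_on ?W" using assms by (simp add: disc_maps_def)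
    from holomorphic_derivI[OF this W, of w]
    have "((\<lambda>u. snd c (h u) $ i) has_field_derivative disc_deriv A h w c $ i) (at w)"
      using assms by (simp add: disc_deriv_def)
    moreover have "(*) (disc_deriv A h w c $ i) = (\<lambda>x. x * disc_deriv A h w c $ i)" by (auto simp: fun_eq_iff)
    ultimately show ?thesis by (simp only: has_field_derivative_def)
  qed
  then show "((\<lambda>u. snd c (h u)) has_derivative (\<lambda>x. x *s disc_deriv A h w c)) (at w)"
    by (intro has_derivative_vec_componentwise) simp
qed

lemma chart_component_DERIV:
  assumes "((\<lambda>u. snd c (h u)) has_derivative (\<lambda>x. x *s v)) (at w)"
  shows "((\<lambda>u. snd c (h u) $ i) has_field_derivative v $ i) (at w)"
proof -
  have "((\<lambda>u. snd c (h u) $ i) has_derivative (\<lambda>x. (x *s v) $ i)) (at w)"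
    by (rule bounded_linear.has_derivative[OF bounded_linear_vec_nth assms])
  also have "(\<lambda>x. (x *s v) $ i) = (*) (v $ i)" by (simp add: fun_eq_iff)
  finally show ?thesis by (simp add: has_field_derivative_def)
qed

lemma disc_mapsI:
  assumes "continuous_map (top_of_set (ball 0 1)) X h"
    and "\<And>w c. w \<in> ball 0 1 \<Longrightarrow> c \<in> A \<Longrightarrow> h w \<in> fst c \<Longrightarrow>
      \<exists>v. ((\<lambda>u. snd c (h u)) has_derivative (\<lambda>x. x *s v)) (at w)"
  shows "h \<in> disc_maps X A"
  unfolding disc_maps_def
proof (intro CollectI conjI ballI allI holomorphic_onI)
  fix c i w assume c: "c \<in> A" and w: "w \<in> {w \<in> ball 0 1. h w \<in> fst c}"
  then obtain v where "((\<lambda>u. snd c (h u)) has_derivative (\<lambda>x. x *s v)) (at w)"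
    using assms(2)[of w c] by blast
  from chart_component_DERIV[OF this]
  show "(\<lambda>w. snd c (h w) $ i) field_differentiable at w within {w \<in> ball 0 1. h w \<in> fst c}"
    by (meson field_differentiable_at_within field_differentiable_def)
qed fact

lemma disc_deriv_eqI:
  assumes "((\<lambda>u. snd c (h u)) has_derivative (\<lambda>x. x *s v)) (at w)" "c \<in> A" "h w \<in> fst c"
  shows "disc_deriv A h w c = v"
  using assms chart_component_DERIV[OF assms(1)]
  by (simp add: disc_deriv_def vec_eq_iff DERIV_imp_deriv)

lemma self_map_disc_has_derivative:
  assumes g: "holomorphic_self_map X A g" and h: "h \<in> disc_maps X A" and w: "w \<in> ball 0 1"
    and cd: "c \<in> A" "h w \<in> fst c" "d \<in> A" "g (h w) \<in> fst d"
  shows "((\<lambda>u. snd d ((g \<circ> h) u)) has_derivative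
    (\<lambda>x. x *s coord_derivative c g d (h w) (disc_deriv A h w c))) (at w)"
proof -
  let ?G = "snd d \<circ> g \<circ> chart_inv c"
  have "((\<lambda>u. ?G (snd c (h u))) has_derivative
      (\<lambda>x. coord_derivative c g d (h w) (x *s disc_deriv A h w c))) (at w)"
    by (rule has_derivative_compose[OF disc_maps_has_derivative(1) coord_derivative(1)]) (use assms in auto)
  then have "((\<lambda>u. snd d ((g \<circ> h) u)) has_derivative
      (\<lambda>x. coord_derivative c g d (h w) (x *s disc_deriv A h w c))) (at w)"
    by (rule has_derivative_transform_within_open[OF _ disc_maps_has_derivative(2)[OF h w cd(1,2)]])
      (use assms in auto)
  then show ?thesis by (simp add: coord_derivative(2) assms)
qed

lemma disc_maps_compose:
  assumes g: "holomorphic_self_map X A g" and h: "h \<in> disc_maps X A"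
  shows "g \<circ> h \<in> disc_maps X A"
    and "w \<in> ball 0 1 \<Longrightarrow> disc_deriv A (g \<circ> h) w = differential A g (h w) (disc_deriv A h w)"
proof -
  have cont: "continuous_map (top_of_set (ball 0 1)) X h" by (rule disc_maps_continuous[OF h])
  have hw: "h w \<in> topspace X" if "w \<in> ball 0 1" for w using cont that by (auto simp: continuous_map_def)
  note D = self_map_disc_has_derivative[OF g h]
  show "g \<circ> h \<in> disc_maps X A"
  proof (rule disc_mapsI)
    show "continuous_map (top_of_set (ball 0 1)) X (g \<circ> h)"
      by (rule continuous_map_compose[OF cont self_map_continuous[OF g]])
    show "\<exists>v. ((\<lambda>u. snd c ((g \<circ> h) u)) has_derivative (\<lambda>x. x *s v)) (at w)"
      if "w \<in> ball 0 1" "c \<in> A" "(g \<circ> h) w \<in> fst c" for w c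
      using D[of w "chart_at (h w)" c] chart_at[OF hw] that by auto
  qed
  assume w: "w \<in> ball 0 1"
  show "disc_deriv A (g \<circ> h) w = differential A g (h w) (disc_deriv A h w)"
  proof
    fix d
    show "disc_deriv A (g \<circ> h) w d = differential A g (h w) (disc_deriv A h w) d"
    proof (cases "d \<in> A \<and> g (h w) \<in> fst d")
      case True
      then show ?thesis
        using disc_deriv_eqI[OF D[of w "chart_at (h w)" d]] chart_at[OF hw[OF w]] w by (simp add: differential_apply comp_def)
    qed (auto simp: disc_deriv_def differential_apply)
  qed
qed

text \<open>Every tangent vector is, up to scaling, the velocity of a disc: a small affine disc in a chart. The
  set of admissible \<open>l\<close> in the definition of the Kobayashi metric is therefore nonempty, without
  which its infimum would carry no information.\<close>
lemma ex_disc_tangent: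
  assumes v: "v \<in> tangent_space A z" and z: "z \<in> topspace X"
  shows "\<exists>l>0. \<exists>h\<in>disc_maps X A. h 0 = z \<and> disc_deriv A h 0 = (\<lambda>c. v c /\<^sub>R l)"
proof -
  define c where "c = chart_at z"
  have c: "c \<in> A" "z \<in> fst c" using chart_at[OF z] by (auto simp: c_def)
  have "open (snd c ` fst c)" "snd c z \<in> snd c ` fst c" using chart[OF c(1)] c by (auto simp: is_chart_def)
  then obtain \<rho> r where r: "\<rho> > 0" "r > 0" "\<forall>x\<in>ball (snd c z) \<rho>. \<forall>w\<in>cball 0 r. x + w *s v c \<in> snd c ` fst c"
    using uniform_complex_line_in_open by metis
  \<comment> \<open>The rescaling makes the affine disc in direction \<open>e\<close> live on the unit disc.\<close>
  define e where "e = complex_of_real r *s v c"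
  have e: "e = r *\<^sub>R v c" by (simp add: e_def of_real_vector_scalar_mult)
  define h where "h w = chart_inv c (snd c z + w *s e)" for w
  have dom: "snd c z + w *s e \<in> snd c ` fst c" if "w \<in> ball 0 1" for w
  proof -
    have "w * of_real r \<in> cball 0 r" using that \<open>r > 0\<close> by (simp add: norm_mult)
    with r have "snd c z + (w * of_real r) *s v c \<in> snd c ` fst c" by auto
    then show ?thesis by (simp add: e_def vector_smult_assoc)
  qed
  have h: "h w \<in> fst c" "snd c (h w) = snd c z + w *s e" if "w \<in> ball 0 1" for w
    using dom[OF that] c(1) by (auto simp: h_def)
  have D: "((\<lambda>u. snd d (h u)) has_derivative (\<lambda>x. x *s coord_derivative c id d (h w) e)) (at w)"
    if "w \<in> ball 0 1" "d \<in> A" "h w \<in> fst d" for w d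
  proof -
    have "(snd d \<circ> id \<circ> chart_inv c has_derivative coord_derivative c id d (h w)) (at (snd c z + w *s e))"
      using coord_derivative(1)[OF holomorphic_self_map_id c(1) that(2), of "h w"] h that by simp
    then have "((\<lambda>w. (snd d \<circ> id \<circ> chart_inv c) (snd c z + w *s e)) has_derivative
        (\<lambda>x. coord_derivative c id d (h w) (x *s e))) (at w)"
      by (rule complex_line_derivative)
    then show ?thesis
      using coord_derivative(2)[OF holomorphic_self_map_id c(1) that(2), of "h w"] h that
      by (simp add: h_def[abs_def])
  qed
  have cont: "continuous_map (top_of_set (ball 0 1)) X h"
  proof -
    have "continuous_map (top_of_set (ball 0 1)) (top_of_set (snd c ` fst c)) (\<lambda>w. snd c z + w *s e)"
      using dom by (auto intro!: continuous_intros)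
    from continuous_map_compose[OF this continuous_map_chart_inv[OF chart[OF c(1)]]]
    show ?thesis by (simp add: o_def h_def[abs_def])
  qed
  have disc: "h \<in> disc_maps X A" using cont D by (intro disc_mapsI) blast+
  have h0: "h 0 = z" using c by (simp add: h_def)
  have "disc_deriv A h 0 d = r *\<^sub>R v d" for d
  proof (cases "d \<in> A \<and> z \<in> fst d")
    case True
    then have "disc_deriv A h 0 d = coord_derivative c id d z e"
      using disc_deriv_eqI[OF D[of 0 d]] h0 by simp
    also have "\<dots> = of_real r *s coord_derivative c id d z (v c)"
      unfolding e_def using coord_derivative(2)[OF holomorphic_self_map_id c(1)] c True by simp
    also have "coord_derivative c id d z (v c) = v d"
      using tangent_space_transform[OF v c(1) _ c(2)] True by simp
    finally show ?thesis by (simp add: of_real_vector_scalar_mult)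
  next
    case False
    then have "v d = 0" by (rule tangent_space_zero[OF v])
    with False show ?thesis using h0 by (auto simp: disc_deriv_def)
  qed
  then have "disc_deriv A h 0 = (\<lambda>c. v c /\<^sub>R (1 / r))" by auto
  with disc h0 \<open>r > 0\<close> show ?thesis by (intro exI[of _ "1 / r"]) auto
qed

text \<open>The Schwarz lemma of the theory: composing with \<open>g\<close> turns any disc competing at \<open>(z, v)\<close> into one
  competing at \<open>(g z, Dg(z)v)\<close> with the same \<open>l\<close>.\<close>
lemma kobayashi_metric_decreasing:
  assumes g: "holomorphic_self_map X A g" and z: "z \<in> topspace X" and v: "v \<in> tangent_space A z"
  shows "kobayashi_metric X A (g z) (differential A g z v) \<le> kobayashi_metric X A z v"
  unfolding kobayashi_metric_def
proof (rule cInf_superset_mono)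
  show "{l. l > 0 \<and> (\<exists>h\<in>disc_maps X A. h 0 = z \<and> disc_deriv A h 0 = (\<lambda>c. v c /\<^sub>R l))} \<noteq> {}"
    using ex_disc_tangent[OF v z] by blast
  show "{l. l > 0 \<and> (\<exists>h\<in>disc_maps X A. h 0 = z \<and> disc_deriv A h 0 = (\<lambda>c. v c /\<^sub>R l))} \<subseteq>
    {l. l > 0 \<and> (\<exists>h\<in>disc_maps X A. h 0 = g z \<and> disc_deriv A h 0 = (\<lambda>c. differential A g z v c /\<^sub>R l))}"
  proof clarify
    fix l :: real and h assume "h \<in> disc_maps X A" "z = h 0" "disc_deriv A h 0 = (\<lambda>c. v c /\<^sub>R l)"
    then show "\<exists>k\<in>disc_maps X A. k 0 = g (h 0) \<and> disc_deriv A k 0 = (\<lambda>c. differential A g (h 0) v c /\<^sub>R l)"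
      using disc_maps_compose[OF g] differential_scaleR[OF g z] by (intro bexI[of _ "g \<circ> h"]) auto
  qed
qed (auto intro!: bdd_belowI[of _ 0])

section \<open>Images of piecewise smooth curves\<close>

lemma ex_open_curve_in_chart:
  assumes "continuous_map (top_of_set {0..1}) X \<gamma>" "c \<in> A"
  obtains U where "open U" "{s \<in> {0..1}. \<gamma> s \<in> fst c} = {0..1} \<inter> U"
proof -
  have "openin (top_of_set {0..1}) {s \<in> topspace (top_of_set {0..1}). \<gamma> s \<in> fst c}"
    by (intro openin_continuous_map_preimage[OF assms(1)] openin_chart assms)
  then show ?thesis using that by (auto simp: openin_open)
qed

text \<open>The nodes of the partition are kept. Near each parameter the image curve is, in a chart, the
  composition of a smooth curve with the holomorphic coordinate expression of \<open>g\<close>.\<close>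
lemma piecewise_smooth_curve_compose:
  assumes g: "holomorphic_self_map X A g" and \<gamma>: "piecewise_smooth_curve X A \<gamma>"
  shows "piecewise_smooth_curve X A (g \<circ> \<gamma>)"
proof -
  have cont: "continuous_map (top_of_set {0..1}) X \<gamma>" using \<gamma> unfolding piecewise_smooth_curve_def by (rule conjunct1)
  have cont': "continuous_map (top_of_set {0..1}) X (g \<circ> \<gamma>)"
    by (rule continuous_map_compose[OF cont self_map_continuous[OF g]])
  obtain T where T: "finite T" "{0, 1} \<subseteq> T" "T \<subseteq> {0..1}"
    and "\<forall>a\<in>T. \<forall>b\<in>T. a < b \<and> T \<inter> {a<..<b} = {} \<longrightarrow>
      (\<forall>c\<in>A. \<forall>k. Ck_on k (snd c \<circ> \<gamma>) {s \<in> {a..b}. \<gamma> s \<in> fst c})"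
    using \<gamma> unfolding piecewise_smooth_curve_def by (elim conjE exE) (rule that)
  then have smooth: "Ck_on k (snd c \<circ> \<gamma>) {s \<in> {a..b}. \<gamma> s \<in> fst c}"
    if "a \<in> T" "b \<in> T" "a < b" "T \<inter> {a<..<b} = {}" "c \<in> A" for a b c k
    using that by blast
  have "Ck_on k (snd d \<circ> (g \<circ> \<gamma>)) {s \<in> {a..b}. (g \<circ> \<gamma>) s \<in> fst d}" (is "Ck_on k ?u ?S")
    if ab: "a \<in> T" "b \<in> T" "a < b" "T \<inter> {a<..<b} = {}" and d: "d \<in> A" for a b d k
  proof -
    have sub: "{a..b} \<subseteq> {0..1}" using ab T(3) by auto
    obtain U0 where U0: "open U0" "{s \<in> {0..1}. (g \<circ> \<gamma>) s \<in> fst d} = {0..1} \<inter> U0"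
      using ex_open_curve_in_chart[OF cont' d] .
    show ?thesis
    proof (rule Ck_on_local[OF \<open>a < b\<close> \<open>open U0\<close>])
      show "?S = {a..b} \<inter> U0" using U0(2) sub by blast
      fix s assume s: "s \<in> ?S"
      then have "\<gamma> s \<in> topspace X" using cont sub by (auto simp: continuous_map_def)
      then obtain c where c: "c \<in> A" "\<gamma> s \<in> fst c" using chart_at by blast
      obtain U where U: "open U" "{s \<in> {0..1}. \<gamma> s \<in> fst c} = {0..1} \<inter> U"
        using ex_open_curve_in_chart[OF cont c(1)] .
      have in_c: "\<gamma> r \<in> fst c" if "r \<in> ?S \<inter> U" for r using that U(2) sub by blast
      let ?G = "snd d \<circ> g \<circ> chart_inv c" and ?\<Omega> = "snd c ` {p \<in> fst c. g p \<in> fst d}"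
      have "Ck_on k (snd c \<circ> \<gamma>) (?S \<inter> U)"
        using in_c by (intro Ck_on_subset[OF smooth[OF ab c(1)]]) auto
      moreover have "holomorphic_vec_on ?G ?\<Omega>"
        using g c(1) d unfolding holomorphic_self_map_def by blast
      moreover have "(snd c \<circ> \<gamma>) ` (?S \<inter> U) \<subseteq> ?\<Omega>" using in_c by auto
      ultimately have "Ck_on k (\<lambda>r. ?G ((snd c \<circ> \<gamma>) r)) (?S \<inter> U)"
        by (intro Ck_on_compose_holomorphic_vec[OF open_coord_domain[OF g c(1) d], of ?G k])
      then have "Ck_on k ?u (?S \<inter> U)"
        by (rule Ck_on_cong) (simp add: in_c c(1))
      moreover have "s \<in> U" using U(2) c(2) s sub by blast
      ultimately show "\<exists>U. open U \<and> s \<in> U \<and> Ck_on k ?u (?S \<inter> U)" using U(1) by blast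
    qed
  qed
  with cont' T show ?thesis
    unfolding piecewise_smooth_curve_def by (intro conjI exI[of _ T] ballI impI allI) auto
qed

lemma self_map_curve_has_vector_derivative:
  assumes g: "holomorphic_self_map X A g" and cont: "continuous_map (top_of_set {0..1}) X \<gamma>"
    and s: "s \<in> {0<..<1}" and cd: "c \<in> A" "\<gamma> s \<in> fst c" "d \<in> A" "g (\<gamma> s) \<in> fst d"
    and u: "((snd c \<circ> \<gamma>) has_vector_derivative u) (at s)"
  shows "((snd d \<circ> (g \<circ> \<gamma>)) has_vector_derivative coord_derivative c g d (\<gamma> s) u) (at s)"
proof -
  obtain U where U: "open U" "{s \<in> {0..1}. \<gamma> s \<in> fst c} = {0..1} \<inter> U"
    using ex_open_curve_in_chart[OF cont cd(1)] .
  have in_c: "\<gamma> r \<in> fst c" if "r \<in> U \<inter> {0<..<1}" for r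
    using that U(2) by (metis (no_types, lifting) IntD1 IntD2 IntI greaterThanLessThan_subseteq_atLeastAtMost_iff mem_Collect_eq order_refl subsetD)
  have "s \<in> {0..1}" using s by simp
  then have sU: "s \<in> U \<inter> {0<..<1}" using U(2) cd(2) s by blast
  let ?G = "snd d \<circ> g \<circ> chart_inv c"
  have "(?G has_derivative coord_derivative c g d (\<gamma> s)) (at ((snd c \<circ> \<gamma>) s) within range (snd c \<circ> \<gamma>))"
    using coord_derivative(1)[OF g cd(1,3,2,4)] by (simp add: has_derivative_at_withinI)
  from vector_derivative_diff_chain_within[OF u this]
  have "(?G \<circ> (snd c \<circ> \<gamma>) has_vector_derivative coord_derivative c g d (\<gamma> s) u) (at s)" .
  then show ?thesis
    by (rule has_vector_derivative_transform_within_open[where S = "U \<inter> {0<..<1}"])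
      (use U(1) sU in_c cd(1) in auto)
qed

lemma velocity_eqI:
  assumes "s \<in> {0<..<1}" "c \<in> A" "\<gamma> s \<in> fst c" "((snd c \<circ> \<gamma>) has_vector_derivative u) (at s)"
  shows "velocity A \<gamma> s c = u"
proof -
  have "at s within {0..1} = at s" using assms(1) by (intro at_within_interior) simp
  then show ?thesis using assms vector_derivative_at[OF assms(4)] by (simp add: velocity_def)
qed

text \<open>Away from the nodes the two-sided derivative exists: such a parameter lies strictly between two
  consecutive nodes.\<close>
lemma velocity_generic:
  assumes \<gamma>: "piecewise_smooth_curve X A \<gamma>"
  obtains T where "finite T" "{0, 1} \<subseteq> T"
    "\<And>s c. s \<in> {0..1} - T \<Longrightarrow> c \<in> A \<Longrightarrow> \<gamma> s \<in> fst c \<Longrightarrow>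
       ((snd c \<circ> \<gamma>) has_vector_derivative velocity A \<gamma> s c) (at s)"
proof -
  have cont: "continuous_map (top_of_set {0..1}) X \<gamma>" using \<gamma> unfolding piecewise_smooth_curve_def by (rule conjunct1)
  obtain T where T: "finite T" "{0, 1} \<subseteq> T" "T \<subseteq> {0..1}"
    and "\<forall>a\<in>T. \<forall>b\<in>T. a < b \<and> T \<inter> {a<..<b} = {} \<longrightarrow>
      (\<forall>c\<in>A. \<forall>k. Ck_on k (snd c \<circ> \<gamma>) {s \<in> {a..b}. \<gamma> s \<in> fst c})"
    using \<gamma> unfolding piecewise_smooth_curve_def by (elim conjE exE) (rule that)
  then have smooth: "Ck_on k (snd c \<circ> \<gamma>) {s \<in> {a..b}. \<gamma> s \<in> fst c}"
    if "a \<in> T" "b \<in> T" "a < b" "T \<inter> {a<..<b} = {}" "c \<in> A" for a b c k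
    using that by blast
  have "((snd c \<circ> \<gamma>) has_vector_derivative velocity A \<gamma> s c) (at s)"
    if s: "s \<in> {0..1} - T" and c: "c \<in> A" "\<gamma> s \<in> fst c" for s c
  proof -
    have s01: "0 < s" "s < 1" using s T(2) by (auto simp: less_le)
    define a where "a = Max {t \<in> T. t < s}"
    define b where "b = Min {t \<in> T. s < t}"
    have "{t \<in> T. t < s} \<noteq> {}" "{t \<in> T. s < t} \<noteq> {}" using T(2) s01 by auto
    then have a: "a \<in> T" "a < s" "\<And>t. t \<in> T \<Longrightarrow> t < s \<Longrightarrow> t \<le> a"
      and b: "b \<in> T" "s < b" "\<And>t. t \<in> T \<Longrightarrow> s < t \<Longrightarrow> b \<le> t"
      using T(1) Max_in[of "{t \<in> T. t < s}"] Min_in[of "{t \<in> T. s < t}"] by (auto simp: a_def b_def)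
    have "T \<inter> {a<..<b} = {}" using a(3) b(3) s by fastforce
    with a b have "Ck_on (Suc 0) (snd c \<circ> \<gamma>) {r \<in> {a..b}. \<gamma> r \<in> fst c}" (is "Ck_on _ _ ?S")
      by (intro smooth c) auto
    then obtain u where "\<forall>r\<in>?S. ((snd c \<circ> \<gamma>) has_vector_derivative u r) (at r within ?S)"
      unfolding Ck_on.simps by (elim exE conjE)
    then have u: "((snd c \<circ> \<gamma>) has_vector_derivative u s) (at s within ?S)"
      by (rule bspec) (use a b c in simp)
    obtain U where U: "open U" "{s \<in> {0..1}. \<gamma> s \<in> fst c} = {0..1} \<inter> U"
      using ex_open_curve_in_chart[OF cont c(1)] .
    have sub: "{a..b} \<subseteq> {0..1}" using a b T(3) by auto
    have "s \<in> U \<inter> {a<..<b}" using U(2) a b c s by auto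
    moreover have "U \<inter> {a<..<b} \<subseteq> ?S"
    proof
      fix r assume "r \<in> U \<inter> {a<..<b}"
      then have "r \<in> {a..b}" "r \<in> {0..1} \<inter> U" using sub by auto
      then show "r \<in> ?S" using U(2) by blast
    qed
    ultimately have "s \<in> interior ?S" using U(1) by (intro interiorI[of "U \<inter> {a<..<b}"]) auto
    then have "at s within ?S = at s" by (rule at_within_interior)
    with u have der: "((snd c \<circ> \<gamma>) has_vector_derivative u s) (at s)" by simp
    have "velocity A \<gamma> s c = u s" using velocity_eqI[OF _ c der] s01 by simp
    with der show ?thesis by simp
  qed
  with T that show ?thesis by blast
qed

text \<open>At the excluded nodes the velocity is arbitrary and need not be a tangent vector; they form a null
  set, which the length does not see.\<close>
lemma velocity_push_forward:
  assumes \<gamma>: "piecewise_smooth_curve X A \<gamma>"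
  obtains T where "finite T"
    "\<And>s. s \<in> {0..1} - T \<Longrightarrow> \<gamma> s \<in> topspace X"
    "\<And>s. s \<in> {0..1} - T \<Longrightarrow> velocity A \<gamma> s \<in> tangent_space A (\<gamma> s)"
    "\<And>s g. s \<in> {0..1} - T \<Longrightarrow> holomorphic_self_map X A g \<Longrightarrow>
       velocity A (g \<circ> \<gamma>) s = differential A g (\<gamma> s) (velocity A \<gamma> s)"
proof -
  have cont: "continuous_map (top_of_set {0..1}) X \<gamma>" using \<gamma> unfolding piecewise_smooth_curve_def by (rule conjunct1)
  obtain T where T: "finite T" "{0, 1} \<subseteq> T"
    and der: "\<And>s c. s \<in> {0..1} - T \<Longrightarrow> c \<in> A \<Longrightarrow> \<gamma> s \<in> fst c \<Longrightarrow>
       ((snd c \<circ> \<gamma>) has_vector_derivative velocity A \<gamma> s c) (at s)"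
    using velocity_generic[OF \<gamma>] by metis
  have open01: "s \<in> {0<..<1}" if "s \<in> {0..1} - T" for s using that T(2) by (auto simp: less_le)
  have top: "\<gamma> s \<in> topspace X" if "s \<in> {0..1} - T" for s
    using cont that by (auto simp: continuous_map_def)
  have push: "velocity A (g \<circ> \<gamma>) s d = coord_derivative c g d (\<gamma> s) (velocity A \<gamma> s c)"
    if "s \<in> {0..1} - T" "holomorphic_self_map X A g" "c \<in> A" "\<gamma> s \<in> fst c" "d \<in> A" "g (\<gamma> s) \<in> fst d" for s g c d
    by (rule velocity_eqI[OF open01[OF that(1)] that(5) _ self_map_curve_has_vector_derivative[OF
          that(2) cont open01[OF that(1)] that(3-6) der[OF that(1,3,4)]]]) (simp add: that(6))
  have "velocity A \<gamma> s \<in> tangent_space A (\<gamma> s)" if s: "s \<in> {0..1} - T" for s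
    unfolding tangent_space_alt
  proof (intro conjI allI ballI impI)
    fix c assume "\<not> (c \<in> A \<and> \<gamma> s \<in> fst c)"
    then show "velocity A \<gamma> s c = 0" by (simp add: velocity_def del: de_Morgan_conj)
  next
    fix c d assume "c \<in> A" "d \<in> A" "\<gamma> s \<in> fst c" "\<gamma> s \<in> fst d"
    then show "velocity A \<gamma> s d = coord_derivative c id d (\<gamma> s) (velocity A \<gamma> s c)"
      using push[OF s holomorphic_self_map_id, of c d] by simp
  qed
  moreover have "velocity A (g \<circ> \<gamma>) s = differential A g (\<gamma> s) (velocity A \<gamma> s)"
    if s: "s \<in> {0..1} - T" and g: "holomorphic_self_map X A g" for s g
  proof
    fix d
    show "velocity A (g \<circ> \<gamma>) s d = differential A g (\<gamma> s) (velocity A \<gamma> s) d"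
    proof (cases "d \<in> A \<and> g (\<gamma> s) \<in> fst d")
      case True
      then show ?thesis using push[OF s g] chart_at[OF top[OF s]] by (simp add: differential_apply)
    next
      case False
      then show ?thesis by (auto simp: velocity_def differential_apply)
    qed
  qed
  ultimately show ?thesis using that T(1) top by blast
qed

section \<open>Contraction of the Kobayashi distance\<close>

lemma kobayashi_length_compose_le:
  assumes g: "holomorphic_self_map X A g" and \<gamma>: "piecewise_smooth_curve X A \<gamma>" and "r > 0"
    and contr: "\<And>z v. z \<in> topspace X \<Longrightarrow> v \<in> tangent_space A z \<Longrightarrow>
      kobayashi_metric X A (g z) (differential A g z v) \<le> r * kobayashi_metric X A z v"
  shows "kobayashi_length X A (g \<circ> \<gamma>) \<le> ennreal r * kobayashi_length X A \<gamma>"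
proof -
  obtain T where T: "finite T"
    and \<gamma>_top: "\<And>s. s \<in> {0..1} - T \<Longrightarrow> \<gamma> s \<in> topspace X"
    and tangent: "\<And>s. s \<in> {0..1} - T \<Longrightarrow> velocity A \<gamma> s \<in> tangent_space A (\<gamma> s)"
    and push: "\<And>s. s \<in> {0..1} - T \<Longrightarrow> velocity A (g \<circ> \<gamma>) s = differential A g (\<gamma> s) (velocity A \<gamma> s)"
    using velocity_push_forward[OF \<gamma>] g by metis
  let ?F = "kobayashi_metric X A"
  have "AE s in lborel. s \<notin> T"
    by (rule AE_not_in) (simp add: T finite_imp_null_set_lborel)
  then have "AE s in lborel. ennreal (?F ((g \<circ> \<gamma>) s) (velocity A (g \<circ> \<gamma>) s)) * indicator {0..1} s
      \<le> ennreal r * (ennreal (?F (\<gamma> s) (velocity A \<gamma> s)) * indicator {0..1} s)"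
  proof eventually_elim
    case (elim s)
    show ?case
    proof (cases "s \<in> {0..1}")
      case True
      with elim have s: "s \<in> {0..1} - T" by simp
      have "?F (g (\<gamma> s)) (velocity A (g \<circ> \<gamma>) s) \<le> r * ?F (\<gamma> s) (velocity A \<gamma> s)"
        unfolding push[OF s] by (rule contr[OF \<gamma>_top[OF s] tangent[OF s]])
      then have "ennreal (?F (g (\<gamma> s)) (velocity A (g \<circ> \<gamma>) s)) \<le> ennreal r * ennreal (?F (\<gamma> s) (velocity A \<gamma> s))"
        using \<open>r > 0\<close> by (simp add: ennreal_leI flip: ennreal_mult')
      then show ?thesis using True by simp
    qed simp
  qed
  then have "kobayashi_length X A (g \<circ> \<gamma>) \<le>
      (\<integral>\<^sup>+ s. ennreal r * (ennreal (?F (\<gamma> s) (velocity A \<gamma> s)) * indicator {0..1} s) \<partial>lborel)"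
    unfolding kobayashi_length_def by (rule nn_integral_mono_AE)
  also have "\<dots> \<le> ennreal r * kobayashi_length X A \<gamma>"
    unfolding kobayashi_length_def by (rule nn_integral_cmult_le[OF \<open>r > 0\<close>])
  finally show ?thesis .
qed

text \<open>A self-map that contracts the Kobayashi metric by the factor \<open>r\<close> contracts the length of every
  curve, and hence the distance, by the same factor.\<close>
lemma kobayashi_dist_self_map_le:
  assumes g: "holomorphic_self_map X A g" and "r > 0"
    and contr: "\<And>z v. z \<in> topspace X \<Longrightarrow> v \<in> tangent_space A z \<Longrightarrow>
      kobayashi_metric X A (g z) (differential A g z v) \<le> r * kobayashi_metric X A z v"
  shows "kobayashi_dist X A (g x) (g y) \<le> ennreal r * kobayashi_dist X A x y"
proof -
  have inv: "ennreal r * ennreal (1 / r) = 1" using \<open>r > 0\<close> by (simp flip: ennreal_mult)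
  \<comment> \<open>With the factor on the left the claim is a lower bound for an infimum.\<close>
  have "ennreal (1 / r) * kobayashi_dist X A (g x) (g y) \<le> kobayashi_dist X A x y"
    unfolding kobayashi_dist_def[of X A x y]
  proof (rule INF_greatest, clarify)
    fix \<gamma> assume \<gamma>: "piecewise_smooth_curve X A \<gamma>" "x = \<gamma> 0" "y = \<gamma> 1"
    have "kobayashi_dist X A (g x) (g y) \<le> kobayashi_length X A (g \<circ> \<gamma>)"
      unfolding kobayashi_dist_def
      using piecewise_smooth_curve_compose[OF g \<gamma>(1)] \<gamma> by (intro INF_lower) auto
    also have "\<dots> \<le> ennreal r * kobayashi_length X A \<gamma>"
      by (rule kobayashi_length_compose_le[OF g \<gamma>(1) \<open>r > 0\<close> contr])
    finally have "ennreal (1 / r) * kobayashi_dist X A (g x) (g y)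
        \<le> ennreal (1 / r) * (ennreal r * kobayashi_length X A \<gamma>)" by (rule mult_left_mono) simp
    also have "\<dots> = kobayashi_length X A \<gamma>" using inv by (simp add: mult.assoc[symmetric] mult.commute)
    finally show "ennreal (1 / r) * kobayashi_dist X A (g (\<gamma> 0)) (g (\<gamma> 1)) \<le> kobayashi_length X A \<gamma>"
      using \<gamma> by simp
  qed
  then have "ennreal r * (ennreal (1 / r) * kobayashi_dist X A (g x) (g y)) \<le> ennreal r * kobayashi_dist X A x y"
    by (rule mult_left_mono) simp
  then show ?thesis by (simp add: mult.assoc[symmetric] inv)
qed

text \<open>Along an orbit the Kobayashi metric is nonincreasing, since each later point is the image of an
  earlier one under the holomorphic map \<open>\<phi> (t - s)\<close>. This is the monotonicity that Gronwall's
  inequality asks for.\<close>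
lemma kobayashi_metric_flow_decay:
  assumes flow: "holomorphic_flow X A f \<phi>" and contr: "intrinsically_contracting X A \<phi> l"
    and z: "z \<in> topspace X" and v: "v \<in> tangent_space A z" and "0 \<le> t"
  shows "kobayashi_metric X A (\<phi> t z) (differential A (\<phi> t) z v) \<le> exp (- l * t) * kobayashi_metric X A z v"
proof -
  let ?\<psi> = "\<lambda>t. kobayashi_metric X A (\<phi> t z) (differential A (\<phi> t) z v)"
  have self: "holomorphic_self_map X A (\<phi> t)" if "0 \<le> t" for t
    using flow that by (simp add: holomorphic_flow_def)
  have semigroup: "\<phi> (s + t) p = \<phi> s (\<phi> t p)" if "p \<in> topspace X" "0 \<le> s" "0 \<le> t" for p s t
    using flow that by (simp add: holomorphic_flow_def)
  \<comment> \<open>Gronwall's inequality ends at the differential of \<open>\<phi> 0\<close>; the Schwarz lemma for \<open>\<phi> 0\<close> leads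
    from there to \<open>v\<close> itself.\<close>
  have "?\<psi> t \<le> exp (- l * t) * ?\<psi> 0"
  proof (rule Dini_Gronwall_antimono[OF _ _ \<open>0 \<le> t\<close>])
    fix s t :: real assume st: "0 \<le> s" "s \<le> t"
    have "\<phi> t p = \<phi> (t - s) (\<phi> s p)" if "p \<in> topspace X" for p
      using semigroup[OF that, of "t - s" s] st by simp
    then have "differential A (\<phi> t) z v = differential A (\<phi> (t - s)) (\<phi> s z) (differential A (\<phi> s) z v)"
      and "\<phi> t z = \<phi> (t - s) (\<phi> s z)"
      using st z by (auto intro!: differential_compose self)
    then show "?\<psi> t \<le> ?\<psi> s"
      using kobayashi_metric_decreasing[OF self[of "t - s"] self_map_topspace[OF self z]
          differential_in_tangent_space[OF self z]] st by simp
  next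
    fix t :: real assume "0 \<le> t"
    then show "upper_Dini ?\<psi> t \<le> ereal (- l * ?\<psi> t)"
      using contr z v by (simp add: intrinsically_contracting_def)
  qed
  also have "\<dots> \<le> exp (- l * t) * kobayashi_metric X A z v"
    using kobayashi_metric_decreasing[OF self[OF order_refl] z v] by simp
  finally show ?thesis .
qed

end

theorem theorem1:
  fixes X :: "'a topology"
    and A :: "('a, 'n::finite) chart set"
    and f :: "'a \<Rightarrow> ('a, 'n) tangent"
    and \<phi> :: "real \<Rightarrow> 'a \<Rightarrow> 'a"
    and rate :: real
  assumes "complex_manifold X A"
    and "kobayashi_hyperbolic X A"
    and "taut X A"
    and "holomorphic_vector_field X A f"
    and "holomorphic_flow X A f \<phi>"
    and "rate > 0"
    and "intrinsically_contracting X A \<phi> rate"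
  shows "\<forall>x\<in>topspace X. \<forall>y\<in>topspace X. \<forall>t\<ge>0.
           kobayashi_dist X A (\<phi> t x) (\<phi> t y) \<le> ennreal (exp (- rate * t)) * kobayashi_dist X A x y"
proof (intro ballI allI impI)
  fix x y and t :: real assume "t \<ge> 0"
  interpret complex_mfd X A by unfold_locales fact
  have "holomorphic_self_map X A (\<phi> t)"
    using assms(5) \<open>t \<ge> 0\<close> by (simp add: holomorphic_flow_def)
  then show "kobayashi_dist X A (\<phi> t x) (\<phi> t y) \<le> ennreal (exp (- rate * t)) * kobayashi_dist X A x y"
    using kobayashi_metric_flow_decay[OF assms(5,7) _ _ \<open>t \<ge> 0\<close>]
    by (intro kobayashi_dist_self_map_le) auto
qed

end
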